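(* Fix $\omega\in\widetilde\Omega$. For any Young diagram $\mu\in\mathbb Y$ and any $r>0$, the following limit relation holds: if positive integers $N(\epsilon)$ satisfy $N(\epsilon)\sim r\epsilon^{-1}$ as $\epsilon\to+0$, then $$\lim_{\epsilon\to+0}{}^{\mathbb{GT}}\Lambda^\infty_{N(\epsilon)}(\epsilon\omega,\underline{0};\mu)={}^{\mathbb{YB}}\Lambda^\infty_r(\omega,\mu).$$
   Context: **Thoma cone.** $\widetilde\Omega\subset\mathbb R_+^\infty\times\mathbb R_+^\infty\times\mathbb R_+$ is the set of triples $\omega=(\alpha,\beta,\delta)$, where $\alpha_1\ge\alpha_2\ge\dots\ge0$, $\beta_1\ge\beta_2\ge\dots\ge0$, $\delta\ge0$ and $\sum_i\alpha_i+\sum_i\beta_i\le\delta$. Put $|\omega|=\delta$, $\epsilon\omega=(\epsilon\alpha,\epsilon\beta,\epsilon\delta)$ for $\epsilon>0$, and $\underline 0=(0,0,0)\in\widetilde\Omega$. **Gelfand–Tsetlin side.** For $(\omega^+,\omega^-)\in\widetilde\Omega\times\widetilde\Omega$, $\omega^\pm=(\alpha^\pm,\beta^\pm,\delta^\pm)$, put $\gamma^\pm=\delta^\pm-\sum_i(\alpha_i^\pm+\beta_i^\pm)\ge0$ and $$\Phi(u;\omega^+,\omega^-)=e^{\gamma^+(u-1)+\gamma^-(u^{-1}-1)}\prod_{i\ge1}\frac{1+\beta_i^+(u-1)}{1-\alpha_i^+(u-1)}\,\frac{1+\beta_i^-(u^{-1}-1)}{1-\alpha_i^-(u^{-1}-1)},$$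 which is analytic in a neighborhood of the circle $|u|=1$, with Laurent expansion $\Phi(u;\omega^+,\omega^-)=\sum_{n\in\mathbb Z}\varphi_n(\omega^+,\omega^-)u^n$ there. For integers $\mu_1\ge\dots\ge\mu_N$ set $${}^{\mathbb{GT}}\Lambda^\infty_N(\omega^+,\omega^-;\mu)=\mathrm{Dim}[\mu,N]\cdot\det\bigl[\varphi_{\mu_i-i+j}(\omega^+,\omega^-)\bigr]_{i,j=1}^N,\qquad \mathrm{Dim}[\mu,N]=\prod_{1\le i<j\le N}\frac{\mu_i-\mu_j-i+j}{j-i}.$$ A Young diagram $\mu$ with at most $N$ nonzero rows is identified with the $N$-tuple obtained by appending zeros. **Young bouquet side.** $\mathbb Y$ is the set of all Young diagrams. For $\omega=(\alpha,\beta,\delta)\in\widetilde\Omega$ put $\gamma=\delta-\sum_i(\alpha_i+\beta_i)$ and define $h_k(\omega)$ by $1+\sum_{k\ge1}h_k(\omega)t^k=e^{\gamma t}\prod_{i\ge1}\frac{1+\beta_it}{1-\alpha_it}$, $h_0=1$, $h_k=0$ for $k<0$; $S_\mu(\omega)=\det[h_{\mu_i-i+j}(\omega)]_{i,j=1}^{\ell(\mu)}$ with $\ell(\mu)$ the number of nonzero rows ($S_\varnothing=1$). Then $${}^{\mathbb{YB}}\Lambda^\infty_r(\omega,\mu)=e^{-r|\omega|}\,\frac{r^{|\mu|}}{|\mu|!}\,\dim\mu\cdot S_\mu(\omega),$$ where $|\mu|$ is the number of boxes and $\dim\mu$ the number of standard Young tableaux of shape $\mu$ ($\dim\varnothing=1$).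 *)

theory Defs
  imports
    "HOL-Analysis.Analysis"
    "HOL-Library.Landau_Symbols"
    "Jordan_Normal_Form.Determinant"
begin

(* All sequences and matrix indices are 0-based: alpha w 0 is the first term alpha_1. *)

record thoma_triple =
  alpha :: "nat \<Rightarrow> real"
  beta :: "nat \<Rightarrow> real"
  delta :: real

definition thoma_cone :: "thoma_triple set" where
  "thoma_cone = {\<omega>. antimono (alpha \<omega>) \<and> (\<forall>i. 0 \<le> alpha \<omega> i) \<and>
                     antimono (beta \<omega>) \<and> (\<forall>i. 0 \<le> beta \<omega> i) \<and> 0 \<le> delta \<omega> \<and>
                     summable (alpha \<omega>) \<and> summable (beta \<omega>) \<and>
                     suminf (alpha \<omega>) + suminf (beta \<omega>) \<le> delta \<omega>}"

definition thoma_scale :: "real \<Rightarrow> thoma_triple \<Rightarrow> thoma_triple" where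
  "thoma_scale \<epsilon> \<omega> = \<lparr>alpha = (\<lambda>i. \<epsilon> * alpha \<omega> i), beta = (\<lambda>i. \<epsilon> * beta \<omega> i), delta = \<epsilon> * delta \<omega>\<rparr>"

definition thoma_zero :: thoma_triple where
  "thoma_zero = \<lparr>alpha = (\<lambda>_. 0), beta = (\<lambda>_. 0), delta = 0\<rparr>"

definition gamma :: "thoma_triple \<Rightarrow> real" where
  "gamma \<omega> = delta \<omega> - (\<Sum>i. alpha \<omega> i + beta \<omega> i)"


definition Phi :: "complex \<Rightarrow> thoma_triple \<Rightarrow> thoma_triple \<Rightarrow> complex" where
  "Phi u \<omega>p \<omega>m =
     exp (of_real (gamma \<omega>p) * (u - 1) + of_real (gamma \<omega>m) * (inverse u - 1)) *
     (\<Prod>i. (1 + of_real (beta \<omega>p i) * (u - 1)) / (1 - of_real (alpha \<omega>p i) * (u - 1)) *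
           ((1 + of_real (beta \<omega>m i) * (inverse u - 1)) /
            (1 - of_real (alpha \<omega>m i) * (inverse u - 1))))"

(* The two-sided coefficient sequence is unique, being determined by the values of f on the
   unit circle.  It may be taken real here because Phi (cnj u) = cnj (Phi u). *)
definition has_laurent_expansion_on_circle :: "(complex \<Rightarrow> complex) \<Rightarrow> (int \<Rightarrow> real) \<Rightarrow> bool" where
  "has_laurent_expansion_on_circle f c \<longleftrightarrow>
     (\<exists>A. open A \<and> sphere 0 1 \<subseteq> A \<and>
          (\<forall>u\<in>A. ((\<lambda>n. of_real (c n) * u powi n) has_sum f u) UNIV))"

definition phi :: "thoma_triple \<Rightarrow> thoma_triple \<Rightarrow> int \<Rightarrow> real" where
  "phi \<omega>p \<omega>m = (THE c. has_laurent_expansion_on_circle (\<lambda>u. Phi u \<omega>p \<omega>m) c)"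

(* An N-tuple of integers is given by the values of \<mu> at 0, ..., N - 1; later values are ignored. *)
definition Dim_GT :: "(nat \<Rightarrow> int) \<Rightarrow> nat \<Rightarrow> real" where
  "Dim_GT \<mu> N = (\<Prod>j<N. \<Prod>i<j.
     (of_int (\<mu> i) - of_int (\<mu> j) - real i + real j) / (real j - real i))"

definition Lambda_GT :: "nat \<Rightarrow> thoma_triple \<Rightarrow> thoma_triple \<Rightarrow> (nat \<Rightarrow> int) \<Rightarrow> real" where
  "Lambda_GT N \<omega>p \<omega>m \<mu> =
     Dim_GT \<mu> N * Determinant.det (Matrix.mat N N (\<lambda>(i, j). phi \<omega>p \<omega>m (\<mu> i - int i + int j)))"


(* A Young diagram is the sequence of its row lengths, continued by zeros; in this form the
   identification with N-tuples for N at least the number of nonzero rows is truncation. *)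
definition young_diagram :: "(nat \<Rightarrow> nat) \<Rightarrow> bool" where
  "young_diagram \<mu> \<longleftrightarrow> antimono \<mu> \<and> finite {i. \<mu> i \<noteq> 0}"

definition num_rows :: "(nat \<Rightarrow> nat) \<Rightarrow> nat" where
  "num_rows \<mu> = card {i. \<mu> i \<noteq> 0}"

definition boxes :: "(nat \<Rightarrow> nat) \<Rightarrow> (nat \<times> nat) set" where
  "boxes \<mu> = {(i, j). j < \<mu> i}"

definition num_boxes :: "(nat \<Rightarrow> nat) \<Rightarrow> nat" where
  "num_boxes \<mu> = card (boxes \<mu>)"

definition standard_tableaux :: "(nat \<Rightarrow> nat) \<Rightarrow> (nat \<times> nat \<Rightarrow> nat) set" where
  "standard_tableaux \<mu> =
     {T \<in> extensional (boxes \<mu>). bij_betw T (boxes \<mu>) {1..num_boxes \<mu>} \<and>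
        (\<forall>i j j'. j < j' \<and> (i, j') \<in> boxes \<mu> \<longrightarrow> T (i, j) < T (i, j')) \<and>
        (\<forall>i i' j. i < i' \<and> (i', j) \<in> boxes \<mu> \<longrightarrow> T (i, j) < T (i', j))}"

definition dim_YB :: "(nat \<Rightarrow> nat) \<Rightarrow> nat" where
  "dim_YB \<mu> = card (standard_tableaux \<mu>)"

definition thoma_h_gen :: "thoma_triple \<Rightarrow> real \<Rightarrow> real" where
  "thoma_h_gen \<omega> t = exp (gamma \<omega> * t) * (\<Prod>i. (1 + beta \<omega> i * t) / (1 - alpha \<omega> i * t))"

(* The generating function is expanded as an analytic function at 0: the infinite product does
   not converge in the X-adic topology of formal power series. *)
definition thoma_h :: "thoma_triple \<Rightarrow> int \<Rightarrow> real" where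
  "thoma_h \<omega> k = (if k < 0 then 0 else fps_nth (THE F. thoma_h_gen \<omega> has_fps_expansion F) (nat k))"

definition thoma_S :: "(nat \<Rightarrow> nat) \<Rightarrow> thoma_triple \<Rightarrow> real" where
  "thoma_S \<mu> \<omega> = Determinant.det
     (Matrix.mat (num_rows \<mu>) (num_rows \<mu>) (\<lambda>(i, j). thoma_h \<omega> (int (\<mu> i) - int i + int j)))"

definition Lambda_YB :: "real \<Rightarrow> thoma_triple \<Rightarrow> (nat \<Rightarrow> nat) \<Rightarrow> real" where
  "Lambda_YB r \<omega> \<mu> =
     exp (- r * delta \<omega>) * (r ^ num_boxes \<mu> / fact (num_boxes \<mu>)) * real (dim_YB \<mu>) * thoma_S \<mu> \<omega>"

end

theory Submission
  imports Defs "HOL-Complex_Analysis.Cauchy_Integral_Formula"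
begin

text \<open>
  Write \<open>H(t) = exp (\<gamma> t) \<Prod>(1 + \<beta>\<^sub>i t) / (1 - \<alpha>\<^sub>i t)\<close> for the generating function of the
  \<open>h\<^sub>k(\<omega>)\<close>. It is analytic near 0, with \<open>H(0) = 1\<close> and \<open>H'(0) = \<delta>\<close>. The function
  \<open>\<Phi>(u; \<epsilon>\<omega>, 0)\<close> is \<open>H(\<epsilon>(u - 1))\<close>, so its expansion in \<open>u\<close> is the Taylor expansion
  of \<open>H\<close> about \<open>- \<epsilon>\<close>. Hence \<open>\<phi>\<^sub>k = 0\<close> for \<open>k < 0\<close>, and \<open>\<phi>\<^sub>k\<close> divided by the
  \<open>k\<close>-th power of \<open>\<epsilon>\<close> tends to \<open>h\<^sub>k(\<omega>)\<close> (\<open>phi_thoma_scale\<close>, \<open>phi_scaling_limit\<close>).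

  Let \<open>n\<close> be the number of rows of \<open>\<mu>\<close>. Below row \<open>n\<close> the matrix of the \<open>\<phi>\<close> is upper
  triangular with diagonal \<open>\<phi>\<^sub>0\<close>, so its determinant is a power of \<open>\<phi>\<^sub>0\<close> times an
  \<open>n \<times> n\<close> determinant (\<open>det_phi_factorisation\<close>). The three factors of \<open>\<Lambda>\<close> then converge
  separately:

  \<^item> \<open>\<phi>\<^sub>0 ^ (N - n) = H(- \<epsilon>) ^ (N - n)\<close> tends to \<open>exp (- r \<delta>)\<close>, because \<open>N \<epsilon>\<close> tends to \<open>r\<close>
    (\<open>phi_0_power_limit\<close>);
  \<^item> the \<open>n \<times> n\<close> determinant divided by \<open>\<epsilon> ^ |\<mu>|\<close> tends to \<open>S\<^sub>\<mu>(\<omega>)\<close>;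
  \<^item> the dimension times \<open>\<epsilon> ^ |\<mu>|\<close> tends to \<open>r ^ |\<mu>|\<close> times the leading coefficient of the
    dimension as a polynomial in \<open>N\<close> (\<open>Dim_GT_asymp\<close>).

  It remains to identify that coefficient with \<open>dim \<mu> / |\<mu>|!\<close>. A Vandermonde determinant shows that
  it equals the determinant of the \<open>1 / (\<mu>\<^sub>i - i + j)!\<close> (\<open>det_inv_fact_eq_prod\<close>), and this
  determinant satisfies the recursion that one gets by removing the largest entry of a standard
  tableau (\<open>dim_YB_eq_det\<close>).
\<close>

section \<open>Determinants\<close>

abbreviation det_of :: "nat \<Rightarrow> (nat \<Rightarrow> nat \<Rightarrow> real) \<Rightarrow> real" where
  "det_of n f \<equiv> Determinant.det (Matrix.mat n n (\<lambda>(i, j). f i j))"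

lemma det_of_Leibniz:
  "det_of n f = (\<Sum>p | p permutes {..<n}. signof p * (\<Prod>i<n. f i (p i)))"
proof -
  have "det_of n f = (\<Sum>p\<in>{p. p permutes {0..<n}}.
      signof p * (\<Prod>i = 0..<n. Matrix.mat n n (\<lambda>(i, j). f i j) $$ (i, p i)))"
    by (rule det_def') simp
  also have "\<dots> = (\<Sum>p\<in>{p. p permutes {..<n}}. signof p * (\<Prod>i<n. f i (p i)))"
    by (intro sum.cong arg_cong2[where f = "(*)"] prod.cong)
       (auto simp: atLeast0LessThan permutes_in_image)
  finally show ?thesis .
qed

lemma det_of_cong:
  assumes "\<And>i j. i < n \<Longrightarrow> j < n \<Longrightarrow> f i j = g i j"
  shows "det_of n f = det_of n g"
  using assms by (intro arg_cong[where f = Determinant.det] eq_matI) auto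

lemma det_of_scale:
  "det_of n (\<lambda>i j. a i * b j * f i j) = (\<Prod>i<n. a i) * (\<Prod>j<n. b j) * det_of n f"
proof -
  have "(\<Prod>i<n. a i * b (p i) * f i (p i)) = (\<Prod>i<n. a i) * (\<Prod>j<n. b j) * (\<Prod>i<n. f i (p i))"
    if "p permutes {..<n}" for p
    using prod.permute[OF that, of b] by (simp add: prod.distrib)
  then show ?thesis
    unfolding det_of_Leibniz sum_distrib_left by (intro sum.cong) (auto simp: mult_ac)
qed

lemma det_of_block_upper:
  assumes "\<And>i j. i < m \<Longrightarrow> j < n \<Longrightarrow> f (n + i) j = 0"
  shows "det_of (n + m) f = det_of n f * det_of m (\<lambda>i j. f (n + i) (n + j))"
proof -
  let ?B = "four_block_mat (Matrix.mat n n (\<lambda>(i, j). f i j)) (Matrix.mat n m (\<lambda>(i, j). f i (n + j)))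
    (0\<^sub>m m n) (Matrix.mat m m (\<lambda>(i, j). f (n + i) (n + j)))"
  have "Matrix.mat (n + m) (n + m) (\<lambda>(i, j). f i j) = ?B"
  proof (rule eq_matI)
    fix i j assume "i < dim_row ?B" "j < dim_col ?B"
    moreover have "f i j = 0" if "n \<le> i" "i < n + m" "j < n"
      using assms[of "i - n" j] that by simp
    ultimately show "Matrix.mat (n + m) (n + m) (\<lambda>(i, j). f i j) $$ (i, j) = ?B $$ (i, j)"
      by (auto simp: not_less)
  qed auto
  then show ?thesis
    by (simp add: det_four_block_mat_lower_left_zero[where n = n and m = m])
qed

text \<open>For the rows below a diagram: there a matrix with entries \<open>c (\<mu>\<^sub>i - i + j)\<close>, where \<open>c\<close>
vanishes on negative arguments, is upper triangular with constant diagonal \<open>c 0\<close>.\<close>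

lemma det_of_upper_triangular_const:
  assumes "\<And>i j. j < i \<Longrightarrow> i < n \<Longrightarrow> f i j = 0" "\<And>i. i < n \<Longrightarrow> f i i = c"
  shows "det_of n f = c ^ n"
proof -
  have "det_of n f = prod_list (diag_mat (Matrix.mat n n (\<lambda>(i, j). f i j)))"
    by (rule det_upper_triangular[where n = n]) (use assms(1) in auto)
  also have "diag_mat (Matrix.mat n n (\<lambda>(i, j). f i j)) = map (\<lambda>_. c) [0..<n]"
    using assms(2) by (auto simp: diag_mat_def)
  finally show ?thesis
    by (simp add: map_replicate_const)
qed

lemma det_of_eq_rows:
  assumes "k < n" "l < n" "k \<noteq> l" "\<And>j. j < n \<Longrightarrow> f k j = f l j"
  shows "det_of n f = 0"
  by (rule det_identical_rows[where i = k and j = l and n = n])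
     (use assms in \<open>auto intro!: eq_vecI\<close>)

lemma det_of_zero_row:
  assumes "k < n" "\<And>j. j < n \<Longrightarrow> f k j = 0"
  shows "det_of n f = 0"
proof -
  have "(\<Prod>i<n. f i (p i)) = 0" if "p permutes {..<n}" for p
    using permutes_in_image[OF that, of k] assms by (intro prod_zero) auto
  then show ?thesis
    unfolding det_of_Leibniz by (intro sum.neutral) (auto simp del: prod_zero_iff)
qed

lemma tendsto_det_of:
  assumes "\<And>i j. i < n \<Longrightarrow> j < n \<Longrightarrow> ((\<lambda>x. f x i j) \<longlongrightarrow> g i j) F"
  shows "((\<lambda>x. det_of n (f x)) \<longlongrightarrow> det_of n g) F"
  unfolding det_of_Leibniz
proof (intro tendsto_intros)
  fix p i assume "p \<in> {p. p permutes {..<n}}" "i \<in> {..<n}"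
  then have "p i < n"
    using permutes_in_image[of p "{..<n}" i] by auto
  with \<open>i \<in> {..<n}\<close> show "((\<lambda>x. f x i (p i)) \<longlongrightarrow> g i (p i)) F"
    by (intro assms) auto
qed

section \<open>Determinants of inverse factorials and dimensions\<close>

text \<open>The reciprocal of the factorial, continued by zero to the negative integers as the reciprocal of
the Gamma function \<open>\<Gamma>(m + 1)\<close> dictates. With this value the recursion
\<open>inv_fact (m - 1) = m * inv_fact m\<close> holds without exception, also at \<open>m = 0\<close>.\<close>

definition inv_fact :: "int \<Rightarrow> real" where
  "inv_fact m = (if m < 0 then 0 else 1 / fact (nat m))"

lemma inv_fact_minus_one: "inv_fact (m - 1) = of_int m * inv_fact m"
proof (cases "m \<le> 0")
  case False
  then have "nat m = Suc (nat (m - 1))" by auto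
  then have "(fact (nat m) :: real) = of_int m * fact (nat (m - 1))"
    using False by simp
  then show ?thesis using False by (simp add: inv_fact_def)
qed (auto simp: inv_fact_def)

text \<open>This is the homogeneity of the determinant, read off from each Leibniz term separately: lowering
the \<open>k\<close>-th row multiplies the term of the permutation \<open>p\<close> by
\<open>m k - k + p k\<close>, and the shifts \<open>p k - k\<close> cancel in the sum over \<open>k\<close>.\<close>

lemma det_inv_fact_recursion:
  fixes m :: "nat \<Rightarrow> int"
  shows "of_int (\<Sum>i<n. m i) * det_of n (\<lambda>i j. inv_fact (m i - int i + int j)) =
    (\<Sum>k<n. det_of n (\<lambda>i j. inv_fact ((m(k := m k - 1)) i - int i + int j)))"
proof -
  have *: "of_int (\<Sum>i<n. m i) * (\<Prod>i<n. inv_fact (m i - int i + int (p i))) =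
      (\<Sum>k<n. \<Prod>i<n. inv_fact ((m(k := m k - 1)) i - int i + int (p i)))" if p: "p permutes {..<n}" for p
  proof -
    have "(\<Prod>i<n. inv_fact ((m(k := m k - 1)) i - int i + int (p i))) =
        of_int (m k - int k + int (p k)) * (\<Prod>i<n. inv_fact (m i - int i + int (p i)))" if "k < n" for k
    proof -
      have "(\<Prod>i<n. inv_fact ((m(k := m k - 1)) i - int i + int (p i))) =
          (\<Prod>i<n. (if i = k then of_int (m k - int k + int (p k)) else 1) * inv_fact (m i - int i + int (p i)))"
        using inv_fact_minus_one[of "m k - int k + int (p k)"]
        by (intro prod.cong) (auto simp: algebra_simps)
      then show ?thesis
        using that by (simp add: prod.distrib)
    qed
    then have "(\<Sum>k<n. \<Prod>i<n. inv_fact ((m(k := m k - 1)) i - int i + int (p i))) =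
        of_int (\<Sum>k<n. m k - int k + int (p k)) * (\<Prod>i<n. inv_fact (m i - int i + int (p i)))"
      by (simp only: of_int_sum sum_distrib_right) (intro sum.cong; simp)
    moreover have "(\<Sum>k<n. m k - int k + int (p k)) = (\<Sum>k<n. m k)"
      using sum.permute[OF p, of int] by (simp add: sum.distrib sum_subtractf o_def)
    ultimately show ?thesis by simp
  qed
  have "of_int (\<Sum>i<n. m i) * det_of n (\<lambda>i j. inv_fact (m i - int i + int j)) =
     (\<Sum>p | p permutes {..<n}. signof p * (of_int (\<Sum>i<n. m i) * (\<Prod>i<n. inv_fact (m i - int i + int (p i)))))"
    by (simp add: det_of_Leibniz sum_distrib_left mult_ac)
  also have "\<dots> = (\<Sum>p | p permutes {..<n}. signof p *
      (\<Sum>k<n. \<Prod>i<n. inv_fact ((m(k := m k - 1)) i - int i + int (p i))))"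
    by (intro sum.cong) (auto simp only: * mem_Collect_eq)
  finally show ?thesis
    unfolding det_of_Leibniz by (simp only: sum_distrib_left sum.swap[of _ "{..<n}"])
qed

text \<open>A Vandermonde determinant in the Newton basis. Adding to every column a multiple of the next one
replaces the falling factorial of degree \<open>d + 1\<close> by \<open>x i - x n\<close> times the one of
degree \<open>d\<close>; this clears the last row except for its final entry, and the factors
\<open>x i - x n\<close> come out of the rows.\<close>

lemma det_falling_factorials:
  fixes x :: "nat \<Rightarrow> real"
  shows "det_of n (\<lambda>i j. \<Prod>k<n - 1 - j. (x i - real k)) = (\<Prod>j<n. \<Prod>i<j. (x i - x j))"
proof (induction n)
  case (Suc n)
  let ?M = "Matrix.mat (Suc n) (Suc n) (\<lambda>(i, j). \<Prod>k<n - j. (x i - real k))"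
  let ?U = "Matrix.mat (Suc n) (Suc n)
    (\<lambda>(i, j). if i = j then 1 else if i = Suc j then real (n - Suc j) - x n else 0)"
  let ?g = "\<lambda>i j. if j < n then (x i - x n) * (\<Prod>k<n - 1 - j. (x i - real k)) else 1"
  \<comment> \<open>The column operations are the multiplication by a unitriangular matrix from the right.\<close>
  have "Determinant.det ?U = prod_list (diag_mat ?U)"
    by (rule det_lower_triangular[where n = "Suc n"]) auto
  also have "diag_mat ?U = map (\<lambda>_. 1) [0..<Suc n]"
    by (auto simp: diag_mat_def)
  finally have U: "Determinant.det ?U = 1"
    by (simp add: map_replicate_const del: upt_Suc)
  have "?M * ?U = Matrix.mat (Suc n) (Suc n) (\<lambda>(i, j). ?g i j)"
  proof (rule eq_matI)
    fix i j assume "i < dim_row (Matrix.mat (Suc n) (Suc n) (\<lambda>(i, j). ?g i j))"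
      "j < dim_col (Matrix.mat (Suc n) (Suc n) (\<lambda>(i, j). ?g i j))"
    then have ij: "i < Suc n" "j < Suc n" by auto
    have "(?M * ?U) $$ (i, j) = (\<Sum>l = 0..<Suc n. (\<Prod>k<n - l. (x i - real k)) *
        (if l = j then 1 else if l = Suc j then real (n - Suc j) - x n else 0))"
      using ij by (simp add: scalar_prod_def del: sum.op_ivl_Suc)
    also have "\<dots> = (\<Sum>l = 0..<Suc n. (if l = j then (\<Prod>k<n - j. (x i - real k)) else 0) +
        (if l = Suc j then (\<Prod>k<n - Suc j. (x i - real k)) * (real (n - Suc j) - x n) else 0))"
      by (intro sum.cong) auto
    also have "\<dots> = (\<Prod>k<n - j. (x i - real k)) +
       (if j < n then (\<Prod>k<n - Suc j. (x i - real k)) * (real (n - Suc j) - x n) else 0)"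
      using ij by (simp add: sum.distrib del: sum.op_ivl_Suc)
    also have "\<dots> = ?g i j"
    proof (cases "j < n")
      case True
      then have "n - j = Suc (n - Suc j)" by auto
      then show ?thesis using True by (simp add: algebra_simps)
    qed auto
    finally show "(?M * ?U) $$ (i, j) = Matrix.mat (Suc n) (Suc n) (\<lambda>(i, j). ?g i j) $$ (i, j)"
      using ij by simp
  qed auto
  then have "Determinant.det ?M = det_of (n + 1) ?g"
    using det_mult[of ?M "Suc n" ?U] U by simp
  also have "\<dots> = det_of n ?g * det_of 1 (\<lambda>i j. ?g (n + i) (n + j))"
    by (rule det_of_block_upper) auto
  also have "det_of 1 (\<lambda>i j. ?g (n + i) (n + j)) = 1"
    by (subst det_of_upper_triangular_const[where c = 1]) auto
  also have "det_of n ?g = det_of n (\<lambda>i j. (x i - x n) * 1 * (\<Prod>k<n - 1 - j. (x i - real k)))"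
    by (rule det_of_cong) auto
  also have "\<dots> = (\<Prod>i<n. (x i - x n)) * (\<Prod>j<n. \<Prod>i<j. (x i - x j))"
    unfolding det_of_scale Suc.IH by simp
  finally show ?case by simp
qed simp

lemma inv_fact_diff_eq: "inv_fact (int l - int d) = (\<Prod>k<d. (real l - real k)) / fact l"
proof (induction d)
  case (Suc d)
  have "inv_fact (int l - int (Suc d)) = of_int (int l - int d) * inv_fact (int l - int d)"
    using inv_fact_minus_one[of "int l - int d"] by (simp add: algebra_simps)
  then show ?case by (simp add: Suc.IH)
qed (simp add: inv_fact_def)

text \<open>With the shifted parts \<open>l i = \<mu> i + n - 1 - i\<close> the entry is \<open>1 / (l i - d)!\<close> for
\<open>d = n - 1 - j\<close>, that is the falling factorial of \<open>l i\<close> of degree \<open>d\<close> divided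
by \<open>(l i)!\<close>. So the determinant is Frobenius' product for the number of standard tableaux.\<close>

lemma det_inv_fact_eq_prod:
  "det_of n (\<lambda>i j. inv_fact (int (\<mu> i) - int i + int j)) =
   (\<Prod>j<n. \<Prod>i<j. (real (\<mu> i) - real (\<mu> j) - real i + real j)) / (\<Prod>i<n. fact (\<mu> i + (n - 1 - i)))"
proof -
  let ?l = "\<lambda>i. \<mu> i + (n - 1 - i)"
  have "det_of n (\<lambda>i j. inv_fact (int (\<mu> i) - int i + int j)) =
      det_of n (\<lambda>i j. (1 / fact (?l i)) * 1 * (\<Prod>k<n - 1 - j. (real (?l i) - real k)))"
  proof (rule det_of_cong)
    fix i j assume "i < n" "j < n"
    then have "int (\<mu> i) - int i + int j = int (?l i) - int (n - 1 - j)" by auto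
    then show "inv_fact (int (\<mu> i) - int i + int j) =
        (1 / fact (?l i)) * 1 * (\<Prod>k<n - 1 - j. (real (?l i) - real k))"
      by (simp only: inv_fact_diff_eq) simp
  qed
  also have "\<dots> = (\<Prod>j<n. \<Prod>i<j. (real (?l i) - real (?l j))) / (\<Prod>i<n. fact (?l i))"
    unfolding det_of_scale det_falling_factorials by (simp add: prod_dividef)
  also have "(\<Prod>j<n. \<Prod>i<j. (real (?l i) - real (?l j))) =
      (\<Prod>j<n. \<Prod>i<j. (real (\<mu> i) - real (\<mu> j) - real i + real j))"
    by (intro prod.cong) (auto simp: of_nat_diff)
  finally show ?thesis .
qed

text \<open>Only the pairs \<open>i < n \<le> j\<close> distinguish the two dimensions, because a pair of zero rows contributes the
factor 1. For fixed \<open>i\<close> the product over \<open>j\<close> telescopes to a quotient of rising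
factorials, which is a polynomial in \<open>N\<close> of degree \<open>\<mu> i\<close>.\<close>

lemma Dim_GT_eq:
  assumes "\<And>i. n \<le> i \<Longrightarrow> \<mu> i = 0" "n \<le> N"
  shows "Dim_GT (\<lambda>i. int (\<mu> i)) N =
    Dim_GT (\<lambda>i. int (\<mu> i)) n * (\<Prod>i<n. pochhammer (real (N - i)) (\<mu> i) / pochhammer (real (n - i)) (\<mu> i))"
  using assms(2)
proof (induction N rule: dec_induct)
  case base
  have "pochhammer (real (n - i)) (\<mu> i) / pochhammer (real (n - i)) (\<mu> i) = 1" if "i < n" for i
    using that pochhammer_pos[of "real (n - i)" "\<mu> i"] by simp
  then show ?case by simp
next
  case (step N)
  have "(\<Prod>i<N. (real (\<mu> i) - real (\<mu> N) - real i + real N) / (real N - real i)) =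
      (\<Prod>i<n. (real (\<mu> i) - real (\<mu> N) - real i + real N) / (real N - real i))"
    using step.hyps assms(1) by (intro prod.mono_neutral_right) auto
  also have "\<dots> = (\<Prod>i<n. pochhammer (real (Suc N - i)) (\<mu> i) / pochhammer (real (N - i)) (\<mu> i))"
  proof (intro prod.cong refl)
    fix i assume "i \<in> {..<n}"
    then have i: "i < N" using step.hyps by auto
    define x where "x = real (N - i)"
    have x: "x > 0" "real (Suc N - i) = x + 1" "real N - real i = x" using i by (auto simp: x_def of_nat_diff)
    have "x * pochhammer (x + 1) (\<mu> i) = pochhammer x (\<mu> i) * (x + real (\<mu> i))"
      using pochhammer_rec[of x "\<mu> i"] pochhammer_Suc[of x "\<mu> i"] by simp
    moreover have "pochhammer x (\<mu> i) > 0" using x by (intro pochhammer_pos)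
    ultimately have "(real (\<mu> i) + x) / x = pochhammer (x + 1) (\<mu> i) / pochhammer x (\<mu> i)"
      using x by (simp add: field_simps)
    moreover have "\<mu> N = 0" using assms(1) step.hyps by auto
    ultimately show "(real (\<mu> i) - real (\<mu> N) - real i + real N) / (real N - real i) =
        pochhammer (real (Suc N - i)) (\<mu> i) / pochhammer (real (N - i)) (\<mu> i)"
      by (simp add: x(2,3) x_def[symmetric] algebra_simps flip: x(3))
  qed
  finally have *: "Dim_GT (\<lambda>i. int (\<mu> i)) (Suc N) = Dim_GT (\<lambda>i. int (\<mu> i)) N *
      (\<Prod>i<n. pochhammer (real (Suc N - i)) (\<mu> i) / pochhammer (real (N - i)) (\<mu> i))"
    by (simp add: Dim_GT_def)
  have "pochhammer (real (N - i)) (\<mu> i) \<noteq> 0" if "i < n" for i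
    using that step.hyps pochhammer_pos[of "real (N - i)" "\<mu> i"] by simp
  then show ?case
    unfolding * step.IH mult.assoc prod.distrib[symmetric]
    by (intro arg_cong2[where f = "(*)"] prod.cong) auto
qed

lemma prod_fact_eq_prod_pochhammer:
  "(\<Prod>i<n. fact (\<mu> i + (n - 1 - i))) =
   (\<Prod>j<n. \<Prod>i<j. (real j - real i)) * (\<Prod>i<n. pochhammer (real (n - i)) (\<mu> i))"
proof -
  have "(\<Prod>i<j. (real j - real i)) = fact j" for j
  proof -
    have "(\<Prod>i<j. (real j - real i)) = (\<Prod>i<j. real (Suc i))"
      by (rule prod.reindex_bij_witness[of _ "\<lambda>i. j - 1 - i" "\<lambda>i. j - 1 - i"])
         (auto simp: of_nat_diff)
    then show ?thesis
      by (simp add: fact_prod_Suc atLeast0LessThan)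
  qed
  then have "(\<Prod>j<n. \<Prod>i<j. (real j - real i)) = (\<Prod>j<n. fact j)"
    by simp
  also have "\<dots> = (\<Prod>i<n. fact (n - 1 - i))"
    by (rule prod.reindex_bij_witness[of _ "\<lambda>i. n - 1 - i" "\<lambda>i. n - 1 - i"]) auto
  finally have *: "(\<Prod>j<n. \<Prod>i<j. (real j - real i)) = (\<Prod>i<n. fact (n - 1 - i))" .
  have "fact (\<mu> i + (n - 1 - i)) = fact (n - 1 - i) * pochhammer (real (n - i)) (\<mu> i)" if "i < n" for i
  proof -
    have "real (n - i) = 1 + real (n - 1 - i)" using that by (auto simp: of_nat_diff)
    then show ?thesis
      using pochhammer_product[of "n - 1 - i" "\<mu> i + (n - 1 - i)" "1 :: real"]
      by (simp add: pochhammer_fact)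
  qed
  then show ?thesis
    unfolding * prod.distrib[symmetric] by (intro prod.cong) auto
qed

text \<open>The dimension grows like \<open>N ^ |\<mu>|\<close>, and its leading coefficient is the determinant of
inverse factorials. Here \<open>c\<close> is a parameter of size \<open>r / N\<close>.\<close>

lemma Dim_GT_asymp:
  assumes "\<And>i. n \<le> i \<Longrightarrow> \<mu> i = 0"
    and "filterlim N at_top F" "((\<lambda>x. real (N x) * c x) \<longlongrightarrow> r) F" "(c \<longlongrightarrow> 0) F"
  shows "((\<lambda>x. Dim_GT (\<lambda>i. int (\<mu> i)) (N x) * c x ^ (\<Sum>i<n. \<mu> i)) \<longlongrightarrow>
    r ^ (\<Sum>i<n. \<mu> i) * det_of n (\<lambda>i j. inv_fact (int (\<mu> i) - int i + int j))) F"
proof -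
  have poch: "((\<lambda>x. pochhammer (real (N x - i)) m * c x ^ m) \<longlongrightarrow> r ^ m) F" for i m
  proof (induction m)
    case (Suc m)
    have "((\<lambda>x. real (N x) * c x + (real m - real i) * c x) \<longlongrightarrow> r + (real m - real i) * 0) F"
      by (intro tendsto_intros assms)
    moreover have "eventually (\<lambda>x. i \<le> N x) F"
      using assms(2) by (simp add: filterlim_at_top)
    then have "eventually (\<lambda>x. real (N x) * c x + (real m - real i) * c x = (real (N x - i) + real m) * c x) F"
      by eventually_elim (auto simp: of_nat_diff algebra_simps)
    ultimately have "((\<lambda>x. (real (N x - i) + real m) * c x) \<longlongrightarrow> r) F"
      by (force elim: Lim_transform_eventually)
    from tendsto_mult[OF Suc.IH this] show ?case
      by (simp add: pochhammer_Suc mult_ac)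
  qed simp
  let ?D = "Dim_GT (\<lambda>i. int (\<mu> i)) n"
  have lim: "((\<lambda>x. ?D * (\<Prod>i<n. (pochhammer (real (N x - i)) (\<mu> i) * c x ^ \<mu> i) / pochhammer (real (n - i)) (\<mu> i)))
      \<longlongrightarrow> ?D * (\<Prod>i<n. r ^ \<mu> i / pochhammer (real (n - i)) (\<mu> i))) F"
  proof (intro tendsto_intros poch)
    fix i assume "i \<in> {..<n}"
    then show "pochhammer (real (n - i)) (\<mu> i) \<noteq> 0"
      using pochhammer_pos[of "real (n - i)" "\<mu> i"] by simp
  qed
  have "eventually (\<lambda>x. n \<le> N x) F"
    using assms(2) by (simp add: filterlim_at_top)
  then have ev: "eventually (\<lambda>x. ?D * (\<Prod>i<n. (pochhammer (real (N x - i)) (\<mu> i) * c x ^ \<mu> i) / pochhammer (real (n - i)) (\<mu> i))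
      = Dim_GT (\<lambda>i. int (\<mu> i)) (N x) * c x ^ (\<Sum>i<n. \<mu> i)) F"
    by eventually_elim
       (subst Dim_GT_eq[of n \<mu>, OF assms(1)],
        auto simp: power_sum prod.distrib prod_dividef)
  have eq: "?D * (\<Prod>i<n. r ^ \<mu> i / pochhammer (real (n - i)) (\<mu> i)) =
      r ^ (\<Sum>i<n. \<mu> i) * det_of n (\<lambda>i j. inv_fact (int (\<mu> i) - int i + int j))"
    unfolding det_inv_fact_eq_prod prod_fact_eq_prod_pochhammer
    by (simp add: Dim_GT_def prod_dividef power_sum)
  from Lim_transform_eventually[OF lim ev] show ?thesis
    unfolding eq .
qed

section \<open>Standard Young tableaux\<close>

lemma young_diagramD:
  assumes "young_diagram \<mu>"
  shows "antimono \<mu>" "finite (boxes \<mu>)"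
proof -
  show "antimono \<mu>" using assms by (simp add: young_diagram_def)
  have "boxes \<mu> = (SIGMA i:{i. \<mu> i \<noteq> 0}. {..<\<mu> i})"
    by (auto simp: boxes_def)
  then show "finite (boxes \<mu>)"
    using assms by (simp add: young_diagram_def)
qed

lemma num_boxes_eq_sum:
  assumes "\<And>i. n \<le> i \<Longrightarrow> \<mu> i = 0"
  shows "num_boxes \<mu> = (\<Sum>i<n. \<mu> i)"
proof -
  have "boxes \<mu> = (SIGMA i:{..<n}. {..<\<mu> i})"
    using assms by (force simp: boxes_def not_le[symmetric])
  then show ?thesis by (simp add: num_boxes_def)
qed

lemma finite_standard_tableaux:
  assumes "young_diagram \<mu>"
  shows "finite (standard_tableaux \<mu>)"
proof (rule finite_subset)
  show "standard_tableaux \<mu> \<subseteq> PiE (boxes \<mu>) (\<lambda>_. {1..num_boxes \<mu>})"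
    unfolding standard_tableaux_def PiE_def by (auto dest: bij_betw_apply)
  show "finite (PiE (boxes \<mu>) (\<lambda>_. {1..num_boxes \<mu>}))"
    using young_diagramD(2)[OF assms] by (intro finite_PiE) auto
qed

lemma young_diagram_remove_box:
  assumes "young_diagram \<mu>" "\<mu> (Suc i) < \<mu> i"
  shows "young_diagram (\<mu>(i := \<mu> i - 1))"
    and "boxes (\<mu>(i := \<mu> i - 1)) = boxes \<mu> - {(i, \<mu> i - 1)}"
    and "num_boxes \<mu> = Suc (num_boxes (\<mu>(i := \<mu> i - 1)))"
proof -
  have anti: "\<And>a b. a \<le> b \<Longrightarrow> \<mu> b \<le> \<mu> a" and fin: "finite {i. \<mu> i \<noteq> 0}"
    using assms(1) by (auto simp: young_diagram_def antimono_def)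
  have "(\<mu>(i := \<mu> i - 1)) b \<le> (\<mu>(i := \<mu> i - 1)) a" if "a \<le> b" for a b
  proof (cases "a = i \<and> b \<noteq> i")
    case True
    then have "\<mu> b \<le> \<mu> (Suc i)" using that by (intro anti) auto
    then show ?thesis using True assms(2) by auto
  qed (use anti[OF that] in auto)
  then have "antimono (\<mu>(i := \<mu> i - 1))" by (auto intro: antimonoI)
  moreover have "finite {k. (\<mu>(i := \<mu> i - 1)) k \<noteq> 0}"
    by (rule finite_subset[OF _ fin]) (auto split: if_splits)
  ultimately show "young_diagram (\<mu>(i := \<mu> i - 1))"
    by (simp add: young_diagram_def)
  show *: "boxes (\<mu>(i := \<mu> i - 1)) = boxes \<mu> - {(i, \<mu> i - 1)}"
    by (auto simp: boxes_def split: if_splits)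
  have "(i, \<mu> i - 1) \<in> boxes \<mu>" using assms(2) by (auto simp: boxes_def)
  from card_Suc_Diff1[OF young_diagramD(2)[OF assms(1)] this]
  show "num_boxes \<mu> = Suc (num_boxes (\<mu>(i := \<mu> i - 1)))"
    by (simp only: num_boxes_def *)
qed

text \<open>The largest entry of a tableau that sits at the end of row \<open>i\<close> can be erased and put back:
it satisfies all inequalities of rows and columns automatically, since no box lies to the right
of it or below it.\<close>

lemma bij_betw_restrict_standard_tableaux:
  assumes "young_diagram \<mu>" "\<mu> (Suc i) < \<mu> i"
  defines "\<nu> \<equiv> \<mu>(i := \<mu> i - 1)" and "b \<equiv> (i, \<mu> i - 1)"
  shows "bij_betw (\<lambda>T. restrict T (boxes \<nu>))
    {T \<in> standard_tableaux \<mu>. T b = num_boxes \<mu>} (standard_tableaux \<nu>)"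
proof (rule bij_betw_byWitness[where f' = "\<lambda>T. T(b := num_boxes \<mu>)"])
  have boxes: "boxes \<mu> = insert b (boxes \<nu>)" "b \<notin> boxes \<nu>"
    using young_diagram_remove_box(2)[OF assms(1,2)] assms(2) by (auto simp: \<nu>_def b_def boxes_def)
  have num: "num_boxes \<mu> = Suc (num_boxes \<nu>)"
    using young_diagram_remove_box(3)[OF assms(1,2)] by (simp add: \<nu>_def)
  have ivl: "{1..num_boxes \<mu>} = insert (num_boxes \<mu>) {1..num_boxes \<nu>}"
    using num by auto
  have anti: "\<And>a c. a \<le> c \<Longrightarrow> \<nu> c \<le> \<nu> a"
    using young_diagram_remove_box(1)[OF assms(1,2)] by (auto simp: \<nu>_def young_diagram_def antimono_def)
  have left: "(a, j) \<in> boxes \<nu>" if "(a, j') \<in> boxes \<nu>" "j \<le> j'" for a j j'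
    using that by (auto simp: boxes_def)
  have up: "(a, j) \<in> boxes \<nu>" if "(a', j) \<in> boxes \<nu>" "a \<le> a'" for a a' j
    using that anti[of a a'] by (auto simp: boxes_def)
  show "\<forall>T\<in>{T \<in> standard_tableaux \<mu>. T b = num_boxes \<mu>}. (restrict T (boxes \<nu>))(b := num_boxes \<mu>) = T"
    using boxes by (fastforce simp: standard_tableaux_def extensional_def)
  show "\<forall>T\<in>standard_tableaux \<nu>. restrict (T(b := num_boxes \<mu>)) (boxes \<nu>) = T"
    using boxes by (fastforce simp: standard_tableaux_def extensional_def)
  show "(\<lambda>T. restrict T (boxes \<nu>)) ` {T \<in> standard_tableaux \<mu>. T b = num_boxes \<mu>} \<subseteq> standard_tableaux \<nu>"
  proof safe
    fix T assume T: "T \<in> standard_tableaux \<mu>" "T b = num_boxes \<mu>"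
    have "bij_betw T (boxes \<mu> - {b}) ({1..num_boxes \<mu>} - {num_boxes \<mu>})"
      using T boxes by (intro bij_betw_DiffI) (auto simp: standard_tableaux_def num)
    moreover have "boxes \<mu> - {b} = boxes \<nu>" "{1..num_boxes \<mu>} - {num_boxes \<mu>} = {1..num_boxes \<nu>}"
      using boxes num by auto
    ultimately have "bij_betw (restrict T (boxes \<nu>)) (boxes \<nu>) {1..num_boxes \<nu>}"
      by (subst bij_betw_cong[of _ _ T]) auto
    moreover have "restrict T (boxes \<nu>) (a, j) < restrict T (boxes \<nu>) (a, j')"
      if "j < j'" "(a, j') \<in> boxes \<nu>" for a j j'
      using T that left[of a j' j] boxes by (auto simp: standard_tableaux_def)
    moreover have "restrict T (boxes \<nu>) (a, j) < restrict T (boxes \<nu>) (a', j)"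
      if "a < a'" "(a', j) \<in> boxes \<nu>" for a a' j
      using T that up[of a' j a] boxes by (auto simp: standard_tableaux_def)
    ultimately show "restrict T (boxes \<nu>) \<in> standard_tableaux \<nu>"
      by (simp add: standard_tableaux_def)
  qed
  show "(\<lambda>T. T(b := num_boxes \<mu>)) ` standard_tableaux \<nu> \<subseteq> {T \<in> standard_tableaux \<mu>. T b = num_boxes \<mu>}"
  proof safe
    fix T assume T: "T \<in> standard_tableaux \<nu>"
    let ?T = "T(b := num_boxes \<mu>)"
    have bij: "bij_betw T (boxes \<nu>) {1..num_boxes \<nu>}" using T by (simp add: standard_tableaux_def)
    have small: "T c < num_boxes \<mu>" if "c \<in> boxes \<nu>" for c
      using bij_betw_apply[OF bij that] num by auto
    have "bij_betw ?T (boxes \<nu>) {1..num_boxes \<nu>}"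
      using bij boxes(2) by (subst bij_betw_cong[of _ _ T]) auto
    then have "bij_betw ?T (boxes \<nu> \<union> {b}) ({1..num_boxes \<nu>} \<union> {num_boxes \<mu>})"
      using num by (intro bij_betw_combine) auto
    then have "bij_betw ?T (boxes \<mu>) {1..num_boxes \<mu>}"
      unfolding ivl boxes(1) by simp
    moreover have "?T \<in> extensional (boxes \<mu>)"
      using T boxes by (auto simp: standard_tableaux_def extensional_def)
    moreover have "?T (a, j) < ?T (a, j')" if "j < j'" "(a, j') \<in> boxes \<mu>" for a j j'
    proof (cases "(a, j') = b")
      case True
      then have "(a, j) \<in> boxes \<nu>" using that by (auto simp: boxes_def b_def \<nu>_def)
      then show ?thesis using True small[of "(a, j)"] boxes(2) by auto
    next
      case False
      then have "(a, j') \<in> boxes \<nu>" using that boxes by auto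
      then show ?thesis using T that False left[of a j' j] boxes(2) by (auto simp: standard_tableaux_def)
    qed
    moreover have "?T (a, j) < ?T (a', j)" if "a < a'" "(a', j) \<in> boxes \<mu>" for a a' j
    proof (cases "(a', j) = b")
      case True
      have "\<mu> i \<le> \<mu> a" using that True assms(1) by (auto simp: young_diagram_def antimono_def b_def)
      then have "(a, j) \<in> boxes \<nu>" using that True assms(2) by (auto simp: boxes_def b_def \<nu>_def)
      then show ?thesis using True small[of "(a, j)"] boxes(2) by auto
    next
      case False
      then have "(a', j) \<in> boxes \<nu>" using that boxes by auto
      then show ?thesis using T that False up[of a' j a] boxes(2) by (auto simp: standard_tableaux_def)
    qed
    ultimately show "?T \<in> standard_tableaux \<mu>"
      by (simp add: standard_tableaux_def)
  qed simp
qed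

lemma max_entry_at_corner:
  assumes "young_diagram \<mu>" "num_boxes \<mu> > 0" "T \<in> standard_tableaux \<mu>"
  obtains i where "\<mu> (Suc i) < \<mu> i" "T (i, \<mu> i - 1) = num_boxes \<mu>"
proof -
  have bij: "bij_betw T (boxes \<mu>) {1..num_boxes \<mu>}"
    using assms(3) by (simp add: standard_tableaux_def)
  then obtain i j where ij: "(i, j) \<in> boxes \<mu>" "T (i, j) = num_boxes \<mu>"
    using assms(2) by (auto simp: bij_betw_def image_iff set_eq_iff) (metis One_nat_def Suc_leI order_refl surj_pair)
  have le: "T c \<le> num_boxes \<mu>" if "c \<in> boxes \<mu>" for c
    using bij_betw_apply[OF bij that] by simp
  have "(i, Suc j) \<notin> boxes \<mu>"
    using assms(3) ij(2) le[of "(i, Suc j)"] by (force simp: standard_tableaux_def)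
  then have j: "j = \<mu> i - 1" using ij(1) by (auto simp: boxes_def)
  have "(Suc i, j) \<notin> boxes \<mu>"
    using assms(3) ij(2) le[of "(Suc i, j)"] by (force simp: standard_tableaux_def)
  then have "\<mu> (Suc i) < \<mu> i" using ij(1) j by (auto simp: boxes_def)
  then show thesis using that ij(2) j by blast
qed

text \<open>Sorting the tableaux by the corner that holds the largest entry.\<close>

lemma dim_YB_branching:
  assumes "young_diagram \<mu>" "num_boxes \<mu> > 0"
  shows "dim_YB \<mu> = (\<Sum>i | \<mu> (Suc i) < \<mu> i. dim_YB (\<mu>(i := \<mu> i - 1)))"
proof -
  let ?C = "{i. \<mu> (Suc i) < \<mu> i}"
  let ?X = "\<lambda>i. {T \<in> standard_tableaux \<mu>. T (i, \<mu> i - 1) = num_boxes \<mu>}"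
  have "finite {i. \<mu> i \<noteq> 0}" using assms(1) by (simp add: young_diagram_def)
  then have fin: "finite ?C" by (rule rev_finite_subset) auto
  have "standard_tableaux \<mu> = (\<Union>i\<in>?C. ?X i)"
    using max_entry_at_corner[OF assms] by blast
  then have "dim_YB \<mu> = card (\<Union>i\<in>?C. ?X i)"
    by (simp add: dim_YB_def)
  also have "\<dots> = (\<Sum>i\<in>?C. card (?X i))"
  proof (rule card_UN_disjoint[OF fin])
    show "\<forall>i\<in>?C. finite (?X i)" using finite_standard_tableaux[OF assms(1)] by auto
    show "\<forall>i\<in>?C. \<forall>j\<in>?C. i \<noteq> j \<longrightarrow> ?X i \<inter> ?X j = {}"
    proof (intro ballI impI equals0I)
      fix i j T assume "i \<in> ?C" "j \<in> ?C" "i \<noteq> j" and T: "T \<in> ?X i \<inter> ?X j"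
      then have "(i, \<mu> i - 1) \<in> boxes \<mu>" "(j, \<mu> j - 1) \<in> boxes \<mu>"
        by (auto simp: boxes_def)
      moreover have "inj_on T (boxes \<mu>)" "T (i, \<mu> i - 1) = T (j, \<mu> j - 1)"
        using T by (auto simp: standard_tableaux_def bij_betw_def)
      ultimately show False using \<open>i \<noteq> j\<close> by (auto dest: inj_onD)
    qed
  qed
  also have "\<dots> = (\<Sum>i\<in>?C. dim_YB (\<mu>(i := \<mu> i - 1)))"
    using bij_betw_same_card[OF bij_betw_restrict_standard_tableaux[OF assms(1)]]
    by (intro sum.cong) (auto simp: dim_YB_def)
  finally show ?thesis .
qed

text \<open>Both sides obey the same recursion. If row \<open>k\<close> does not end in a corner, then lowering it
makes it equal to the next row of the matrix, or zero if it is the last one, so exactly the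
corners survive in \<open>det_inv_fact_recursion\<close>. The size \<open>n\<close> may exceed the number of rows, as
it must in the induction, where rows disappear.\<close>

theorem dim_YB_eq_det:
  assumes "young_diagram \<mu>" "\<And>i. n \<le> i \<Longrightarrow> \<mu> i = 0"
  shows "real (dim_YB \<mu>) / fact (num_boxes \<mu>) = det_of n (\<lambda>i j. inv_fact (int (\<mu> i) - int i + int j))"
  using assms
proof (induction "num_boxes \<mu>" arbitrary: \<mu>)
  case 0
  then have "card (boxes \<mu>) = 0" by (simp add: num_boxes_def)
  then have empty: "boxes \<mu> = {}" using young_diagramD(2)[OF "0.prems"(1)] by simp
  then have "\<mu> i = 0" for i by (auto simp: boxes_def)
  then have "det_of n (\<lambda>i j. inv_fact (int (\<mu> i) - int i + int j)) = 1"
    by (subst det_of_upper_triangular_const[where c = 1]) (auto simp: inv_fact_def)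
  moreover have "standard_tableaux \<mu> = {\<lambda>_. undefined}"
    using empty by (auto simp: standard_tableaux_def num_boxes_def bij_betw_def)
  ultimately show ?case using "0.hyps" by (simp add: dim_YB_def)
next
  case (Suc s)
  let ?d = "\<lambda>m. det_of n (\<lambda>i j. inv_fact (m i - int i + int j))"
  let ?m = "\<lambda>i. int (\<mu> i)"
  have anti: "\<And>a b. a \<le> b \<Longrightarrow> \<mu> b \<le> \<mu> a"
    using Suc.prems(1) by (auto simp: young_diagram_def antimono_def)
  have removable: "?d (?m(k := ?m k - 1)) = real (dim_YB (\<mu>(k := \<mu> k - 1))) / fact s"
    if k: "\<mu> (Suc k) < \<mu> k" for k
  proof -
    have "?m(k := ?m k - 1) = (\<lambda>i. int ((\<mu>(k := \<mu> k - 1)) i))" using k by auto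
    moreover have "num_boxes (\<mu>(k := \<mu> k - 1)) = s"
      using young_diagram_remove_box(3)[OF Suc.prems(1) k] Suc.hyps(2) by simp
    moreover have "(\<mu>(k := \<mu> k - 1)) i = 0" if "n \<le> i" for i
      using Suc.prems(2)[OF that] by (cases "i = k") auto
    ultimately show ?thesis
      using Suc.hyps(1)[of "\<mu>(k := \<mu> k - 1)"] young_diagram_remove_box(1)[OF Suc.prems(1) k] by metis
  qed
  have zero: "?d (?m(k := ?m k - 1)) = 0" if "k < n" "\<not> \<mu> (Suc k) < \<mu> k" for k
  proof (cases "Suc k < n")
    case True
    have "\<mu> (Suc k) = \<mu> k" using that(2) anti[of k "Suc k"] by simp
    then show ?thesis
      using True that(1) by (intro det_of_eq_rows[of k n "Suc k"]) (auto simp: algebra_simps)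
  next
    case False
    then have "\<mu> k = 0" using that Suc.prems(2)[of "Suc k"] by simp
    then show ?thesis
      using that(1) False by (intro det_of_zero_row[of k n]) (auto simp: inv_fact_def)
  qed
  have sub: "{k. \<mu> (Suc k) < \<mu> k} \<subseteq> {..<n}"
    using Suc.prems(2) by (force simp: not_le[symmetric])
  have sum: "(\<Sum>i<n. ?m i) = int (Suc s)"
    using num_boxes_eq_sum[OF Suc.prems(2)] Suc.hyps(2) by (simp flip: of_nat_sum)
  have "real (Suc s) * ?d ?m = (\<Sum>k<n. ?d (?m(k := ?m k - 1)))"
    using det_inv_fact_recursion[where m = ?m and n = n] unfolding sum by (simp only: of_int_of_nat_eq)
  also have "\<dots> = (\<Sum>k | \<mu> (Suc k) < \<mu> k. ?d (?m(k := ?m k - 1)))"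
    using sub zero by (intro sum.mono_neutral_right) auto
  also have "\<dots> = real (dim_YB \<mu>) / fact s"
    using dim_YB_branching[OF Suc.prems(1)] Suc.hyps(2) removable
    by (simp add: sum_divide_distrib)
  finally show ?case
    unfolding Suc.hyps(2)[symmetric] by (simp add: field_simps del: of_nat_Suc)
qed

section \<open>Uniqueness of expansions\<close>

lemma has_integral_exp_of_int_circle:
  "((\<lambda>\<theta>. exp (\<i> * of_int k * of_real \<theta>)) has_integral (if k = 0 then 2 * pi else 0)) {0..2 * pi}"
proof (cases "k = 0")
  case True
  then show ?thesis
    using has_integral_const_real[of "1 :: complex" 0 "2 * pi"] by (simp add: scaleR_conv_of_real)
next
  case False
  let ?F = "\<lambda>z. exp (\<i> * of_int k * z) / (\<i> * of_int k)"
  have "((\<lambda>\<theta>. ?F (of_real \<theta>)) has_vector_derivative exp (\<i> * of_int k * of_real \<theta>)) (at \<theta> within {0..2 * pi})" for \<theta> :: real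
    using False by (intro has_vector_derivative_real_field) (auto intro!: derivative_eq_intros)
  then have "((\<lambda>\<theta>. exp (\<i> * of_int k * of_real \<theta>)) has_integral ?F (of_real (2 * pi)) - ?F (of_real 0)) {0..2 * pi}"
    by (intro fundamental_theorem_of_calculus) auto
  moreover have "exp (\<i> * of_int k * of_real (2 * pi)) = (1 :: complex)"
    using exp_integer_2pi[of "of_int k"] by (simp add: mult_ac)
  ultimately show ?thesis using False by simp
qed

text \<open>An absolutely convergent trigonometric series determines its coefficients: a finite part of the
series that carries all but \<open>e\<close> of the absolute sum, and that contains the index
\<open>m\<close>, is bounded by \<open>e\<close> on the circle, and \<open>d m\<close> is the mean of this
finite part against \<open>u powi (- m)\<close>.\<close>

lemma Laurent_coeff_eq_0:
  fixes d :: "int \<Rightarrow> real"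
  assumes "\<And>u. norm u = 1 \<Longrightarrow> ((\<lambda>n. of_real (d n) * u powi n) has_sum (0 :: complex)) UNIV"
  shows "d m = 0"
proof -
  have "\<bar>d m\<bar> \<le> e" if "e > 0" for e
  proof -
    have "(\<lambda>n. complex_of_real (d n)) summable_on UNIV"
      using assms[of 1] by (auto simp: summable_on_def)
    then have abs: "(\<lambda>n. norm (complex_of_real (d n))) summable_on UNIV"
      by (simp only: summable_on_iff_abs_summable_on_complex)
    then obtain S where S: "((\<lambda>n. norm (complex_of_real (d n))) has_sum S) UNIV"
      by (auto simp: summable_on_def)
    then have "\<exists>X. finite X \<and> X \<subseteq> UNIV \<and> (\<forall>Y. finite Y \<and> X \<subseteq> Y \<and> Y \<subseteq> UNIV \<longrightarrow>
        dist (sum (\<lambda>n. norm (complex_of_real (d n))) Y) S < e)"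
      using that by (simp add: has_sum_def tendsto_iff eventually_finite_subsets_at_top)
    then obtain X where X: "finite X"
      "\<And>Y. finite Y \<Longrightarrow> X \<subseteq> Y \<Longrightarrow> dist (sum (\<lambda>n. norm (complex_of_real (d n))) Y) S < e"
      by auto
    define Y where "Y = insert m X"
    have Y: "finite Y" "m \<in> Y" "dist (sum (\<lambda>n. norm (complex_of_real (d n))) Y) S < e"
      using X(1) X(2)[of Y] by (simp_all add: Y_def subset_insertI)
    have bound: "norm (\<Sum>n\<in>Y. of_real (d n) * u powi n) \<le> e" if u: "norm u = 1" for u :: complex
    proof -
      have norm_eq: "norm (of_real (d n) * u powi n) = norm (complex_of_real (d n))" for n
        using u by (simp add: norm_mult norm_power_int)
      have "((\<lambda>n. of_real (d n) * u powi n) has_sum (0 - (\<Sum>n\<in>Y. of_real (d n) * u powi n))) (UNIV - Y)"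
        using Y(1) by (intro has_sum_Diff assms[OF u] has_sum_finite) auto
      moreover have "((\<lambda>n. norm (complex_of_real (d n))) has_sum (S - (\<Sum>n\<in>Y. norm (complex_of_real (d n))))) (UNIV - Y)"
        using Y(1) by (intro has_sum_Diff S has_sum_finite) auto
      ultimately have "norm (0 - (\<Sum>n\<in>Y. of_real (d n) * u powi n)) \<le> S - (\<Sum>n\<in>Y. norm (complex_of_real (d n)))"
        by (rule norm_infsum_le) (simp add: norm_eq)
      then show ?thesis using Y(3) by (simp add: dist_real_def)
    qed
    let ?g = "\<lambda>\<theta>. \<Sum>n\<in>Y. of_real (d n) * exp (\<i> * of_int (n - m) * of_real \<theta>)"
    have "(?g has_integral (\<Sum>n\<in>Y. of_real (d n) * of_real (if n - m = 0 then 2 * pi else 0))) {0..2 * pi}"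
      by (intro has_integral_sum has_integral_mult_right has_integral_exp_of_int_circle Y)
    also have "(\<Sum>n\<in>Y. of_real (d n) * of_real (if n - m = 0 then 2 * pi else 0)) = complex_of_real (2 * pi * d m)"
      using Y by (simp add: if_distrib cong: if_cong)
    finally have int: "(?g has_integral complex_of_real (2 * pi * d m)) (cbox 0 (2 * pi))"
      by simp
    have "norm (?g \<theta>) \<le> e" for \<theta>
    proof -
      let ?u = "exp (\<i> * of_real \<theta>)"
      have "?g \<theta> = exp (\<i> * of_int (- m) * of_real \<theta>) * (\<Sum>n\<in>Y. of_real (d n) * ?u powi n)"
        unfolding sum_distrib_left by (intro sum.cong refl)
          (simp add: exp_power_int algebra_simps flip: exp_add)
      then show ?thesis
        using bound[of ?u] by (simp add: norm_mult)
    qed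
    then have "norm (complex_of_real (2 * pi * d m)) \<le> e * measure lborel (cbox 0 (2 * pi))"
      using \<open>e > 0\<close> by (intro has_integral_bound[OF _ int]) auto
    then have "2 * pi * \<bar>d m\<bar> \<le> 2 * pi * e"
      by (simp add: norm_mult abs_mult)
    then show ?thesis by simp
  qed
  then have "\<bar>d m\<bar> \<le> 0" by (rule field_le_epsilon[of _ 0, simplified])
  then show ?thesis by simp
qed

lemma has_laurent_expansion_on_circle_unique:
  assumes "has_laurent_expansion_on_circle f c" "has_laurent_expansion_on_circle f c'"
  shows "c = c'"
proof
  fix m
  have "((\<lambda>n. of_real (c n - c' n) * u powi n) has_sum 0) UNIV" if "norm u = 1" for u :: complex
  proof -
    have "((\<lambda>n. of_real (c n) * u powi n) has_sum f u) UNIV"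
      "((\<lambda>n. of_real (c' n) * u powi n) has_sum f u) UNIV"
      using assms that unfolding has_laurent_expansion_on_circle_def by (auto simp: subset_iff)
    from has_sum_add[OF this(1) has_sum_cmult_right[OF this(2), of "- 1"]]
    show ?thesis by (simp add: algebra_simps)
  qed
  from Laurent_coeff_eq_0[of "\<lambda>n. c n - c' n", OF this] show "c m = c' m" by simp
qed

text \<open>The symmetry under conjugation makes it possible to average the series with its conjugate, which
replaces the coefficients by their real parts.\<close>

lemma has_laurent_expansion_on_circle_power_series:
  assumes "R > 1" and sums: "\<And>u. norm u < R \<Longrightarrow> (\<lambda>n. a n * u ^ n) sums f u"
    and cnj: "\<And>u. norm u < R \<Longrightarrow> f (cnj u) = cnj (f u)"
  shows "has_laurent_expansion_on_circle f (\<lambda>k. if k < 0 then 0 else Re (a (nat k)))"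
  unfolding has_laurent_expansion_on_circle_def
proof (intro exI[of _ "ball 0 R"] conjI ballI)
  fix u :: complex assume "u \<in> ball 0 R"
  then have u: "norm u < R" by simp
  have has_sum: "((\<lambda>n. a n * u ^ n) has_sum f u) UNIV" if u: "norm u < R" for u
  proof (rule norm_summable_imp_has_sum[OF _ sums[OF u]])
    obtain s where s: "norm u < s" "s < R" using u dense by blast
    moreover have "0 \<le> s" using s(1) norm_ge_zero[of u] by linarith
    ultimately have "norm (complex_of_real s) = s" by simp
    then show "summable (\<lambda>n. norm (a n * u ^ n))"
      using s sums_summable[OF sums[of "of_real s"]] by (intro powser_insidea[of a "of_real s"]) auto
  qed
  have "((\<lambda>n. cnj (a n * cnj u ^ n)) has_sum cnj (f (cnj u))) UNIV"
    using has_sum[of "cnj u"] u by (simp only: has_sum_cnj_iff complex_mod_cnj)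
  from has_sum_add[OF has_sum[OF u] this]
  have "((\<lambda>n. (a n + cnj (a n)) * u ^ n) has_sum (2 * f u)) UNIV"
    using cnj[OF u] by (simp add: algebra_simps)
  from has_sum_cmult_right[OF this, of "1 / 2"]
  have "((\<lambda>n. of_real (Re (a n)) * u ^ n) has_sum f u) UNIV"
    by (simp add: complex_add_cnj)
  moreover have "((\<lambda>k. of_real (if k < 0 then 0 else Re (a (nat k))) * u powi k) has_sum f u) (int ` UNIV)
      \<longleftrightarrow> ((\<lambda>n. of_real (Re (a n)) * u ^ n) has_sum f u) UNIV"
    by (subst has_sum_reindex) (auto simp: o_def power_int_of_nat)
  moreover have "((\<lambda>k. of_real (if k < 0 then 0 else Re (a (nat k))) * u powi k) has_sum f u) (int ` UNIV)
      \<longleftrightarrow> ((\<lambda>k. of_real (if k < 0 then 0 else Re (a (nat k))) * u powi k) has_sum f u) UNIV"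
  proof (rule has_sum_cong_neutral)
    fix k assume "k \<in> UNIV - range int"
    then have "k < 0" by (metis DiffE nonneg_int_cases not_le rangeI)
    then show "of_real (if k < 0 then 0 else Re (a (nat k))) * u powi k = 0" by simp
  qed auto
  ultimately show "((\<lambda>k. of_real (if k < 0 then 0 else Re (a (nat k))) * u powi k) has_sum f u) UNIV"
    by simp
qed (use assms(1) in auto)

text \<open>Once the earlier coefficients are known to vanish, \<open>a n\<close> is the limit at 0 of the series
divided by \<open>x ^ n\<close>.\<close>

lemma power_series_coeff_eq_0:
  fixes a :: "nat \<Rightarrow> 'a :: {real_normed_field, banach}"
  assumes "s > 0" and sums: "\<And>x. norm x < s \<Longrightarrow> (\<lambda>n. a n * x ^ n) sums 0"
  shows "a n = 0"
proof (induction n rule: less_induct)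
  case (less n)
  let ?f = "\<lambda>x :: 'a. if x = 0 then a n else 0"
  have "(\<lambda>k. a (k + n) * x ^ k) sums ?f x" if "norm x < s" for x
  proof (cases "x = 0")
    case True
    then show ?thesis using powser_sums_zero[of "\<lambda>k. a (k + n)"] by simp
  next
    case False
    have "(\<lambda>k. a (k + n) * x ^ (k + n)) sums (0 - (\<Sum>k<n. a k * x ^ k))"
      by (rule sums_split_initial_segment[OF sums[OF that]])
    then have "(\<lambda>k. a (k + n) * x ^ (k + n) / x ^ n) sums ((0 - (\<Sum>k<n. a k * x ^ k)) / x ^ n)"
      by (rule sums_divide)
    then show ?thesis using False less by (simp add: power_add)
  qed
  from powser_limit_0[OF \<open>s > 0\<close> this] have "(?f \<longlongrightarrow> a n) (at 0)" by simp
  moreover have "(?f \<longlongrightarrow> 0) (at 0)"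
    by (rule Lim_transform_eventually[OF tendsto_const]) (auto simp: eventually_at_filter)
  ultimately show "a n = 0"
    using LIM_unique by blast
qed

lemma has_fps_expansion_unique:
  fixes f :: "'a :: {real_normed_field, banach} \<Rightarrow> 'a"
  assumes "f has_fps_expansion F" "f has_fps_expansion G"
  shows "F = G"
proof (rule fps_ext)
  fix n
  have ev: "eventually (\<lambda>x. (\<lambda>n. fps_nth F n * x ^ n) sums f x) (nhds 0)"
    if "f has_fps_expansion F" for F
  proof -
    have "eventually (\<lambda>x. x \<in> eball 0 (fps_conv_radius F)) (nhds (0 :: 'a))"
      using that by (intro eventually_nhds_in_open) (auto simp: has_fps_expansion_def zero_ereal_def)
    moreover have "eventually (\<lambda>x. eval_fps F x = f x) (nhds 0)"
      using that by (simp add: has_fps_expansion_def)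
    ultimately show ?thesis
    proof eventually_elim
      case (elim x)
      then show ?case using sums_eval_fps[of x F] by (simp add: in_eball_iff)
    qed
  qed
  from ev[OF assms(1)] ev[OF assms(2)]
  have "eventually (\<lambda>x. (\<lambda>n. (fps_nth F n - fps_nth G n) * x ^ n) sums 0) (nhds 0)"
  proof eventually_elim
    case (elim x)
    from sums_diff[OF this] show ?case by (simp add: algebra_simps)
  qed
  then obtain s where "s > 0" "\<And>x. norm x < s \<Longrightarrow> (\<lambda>n. (fps_nth F n - fps_nth G n) * x ^ n) sums 0"
    by (auto simp: eventually_nhds_metric dist_norm)
  from power_series_coeff_eq_0[OF this] show "fps_nth F n = fps_nth G n" by simp
qed

lemma Re_of_real_mult: "Re (of_real x * z) = x * Re z"
  by simp

section \<open>The generating function of a point of the Thoma cone\<close>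

text \<open>The complex extension of \<open>thoma_h_gen\<close>. Over the complex numbers, uniform convergence of the
product already implies convergence of all Taylor coefficients.\<close>

definition thoma_gen :: "thoma_triple \<Rightarrow> complex \<Rightarrow> complex" where
  "thoma_gen \<omega> z = exp (of_real (gamma \<omega>) * z) *
     (\<Prod>i. (1 + of_real (beta \<omega> i) * z) / (1 - of_real (alpha \<omega> i) * z))"

text \<open>The poles of the generating function are the inverses of the nonzero \<open>alpha \<omega> i\<close>. This radius
keeps all denominators at least 1/2 in absolute value, and it is itself at most 1/2, so that the
\<open>i\<close>-th factor differs from 1 by at most \<open>alpha \<omega> i + beta \<omega> i\<close>.\<close>

definition thoma_radius :: "thoma_triple \<Rightarrow> real" where
  "thoma_radius \<omega> = 1 / (2 * (1 + alpha \<omega> 0))"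

context
  fixes \<omega> assumes \<omega>: "\<omega> \<in> thoma_cone"
begin

lemma alpha_nonneg: "alpha \<omega> i \<ge> 0" and beta_nonneg: "beta \<omega> i \<ge> 0"
  and alpha_le: "alpha \<omega> i \<le> alpha \<omega> 0"
  and summable_alpha_beta: "summable (\<lambda>i. alpha \<omega> i + beta \<omega> i)"
  using \<omega> by (auto simp: thoma_cone_def antimono_def intro!: summable_add)

lemma thoma_radius_pos: "thoma_radius \<omega> > 0"
  using alpha_nonneg[of 0] by (simp add: thoma_radius_def)

lemma thoma_factor:
  fixes z :: complex
  assumes z: "norm z \<le> thoma_radius \<omega>"
  shows "1 - of_real (alpha \<omega> i) * z \<noteq> 0"
    and "norm ((1 + of_real (beta \<omega> i) * z) / (1 - of_real (alpha \<omega> i) * z) - 1) \<le> alpha \<omega> i + beta \<omega> i"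
proof -
  let ?w = "1 - of_real (alpha \<omega> i) * z"
  have "norm (of_real (alpha \<omega> i) * z) \<le> alpha \<omega> 0 * thoma_radius \<omega>"
    unfolding norm_mult using alpha_nonneg[of i] alpha_le[of i] z by (auto intro!: mult_mono)
  also have "\<dots> \<le> 1 / 2"
    using alpha_nonneg[of 0] by (simp add: thoma_radius_def field_simps)
  finally have w: "norm ?w \<ge> 1 / 2"
    using norm_triangle_ineq2[of 1 "of_real (alpha \<omega> i) * z"] by simp
  then show nz: "?w \<noteq> 0" by auto
  have "thoma_radius \<omega> \<le> 1 / 2"
    using alpha_nonneg[of 0] by (simp add: thoma_radius_def field_simps)
  then have "norm z \<le> norm ?w" using z w by simp
  moreover have "(1 + of_real (beta \<omega> i) * z) / ?w - 1 = of_real (alpha \<omega> i + beta \<omega> i) * (z / ?w)"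
    using nz by (simp add: field_simps)
  moreover have "norm (of_real (alpha \<omega> i + beta \<omega> i) * (z / ?w)) = (alpha \<omega> i + beta \<omega> i) * norm (z / ?w)"
    using alpha_nonneg[of i] beta_nonneg[of i] by (simp only: norm_mult norm_of_real)
  moreover have "norm (z / ?w) \<le> 1"
    using \<open>norm z \<le> norm ?w\<close> nz by (simp add: norm_divide divide_le_eq)
  ultimately show "norm ((1 + of_real (beta \<omega> i) * z) / ?w - 1) \<le> alpha \<omega> i + beta \<omega> i"
    using alpha_nonneg[of i] beta_nonneg[of i] mult_left_mono[of "norm (z / ?w)" 1 "alpha \<omega> i + beta \<omega> i"] by simp
qed

lemma thoma_product_LIMSEQ:
  fixes z :: complex
  assumes "norm z \<le> thoma_radius \<omega>"
  shows "(\<lambda>n. \<Prod>i<n. (1 + of_real (beta \<omega> i) * z) / (1 - of_real (alpha \<omega> i) * z))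
    \<longlonglongrightarrow> (\<Prod>i. (1 + of_real (beta \<omega> i) * z) / (1 - of_real (alpha \<omega> i) * z))"
proof -
  let ?f = "\<lambda>i. (1 + of_real (beta \<omega> i) * z) / (1 - of_real (alpha \<omega> i) * z)"
  have "summable (\<lambda>i. norm (?f i - 1))"
    by (rule summable_comparison_test'[OF summable_alpha_beta, of 0]) (use thoma_factor(2)[OF assms] in simp)
  then have "convergent_prod ?f"
    by (simp add: abs_convergent_prod_conv_summable abs_convergent_prod_imp_convergent_prod)
  then show ?thesis
    using convergent_prod_LIMSEQ LIMSEQ_lessThan_iff_atMost by blast
qed

lemma thoma_product_uniform_limit:
  "uniform_limit (cball 0 (thoma_radius \<omega>))
    (\<lambda>n z. \<Prod>i<n. (1 + complex_of_real (beta \<omega> i) * z) / (1 - of_real (alpha \<omega> i) * z))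
    (\<lambda>z. \<Prod>i. (1 + of_real (beta \<omega> i) * z) / (1 - of_real (alpha \<omega> i) * z)) sequentially"
proof -
  let ?f = "\<lambda>i z. (1 + complex_of_real (beta \<omega> i) * z) / (1 - of_real (alpha \<omega> i) * z)"
  let ?K = "cball 0 (thoma_radius \<omega>)"
  have "uniformly_convergent_on ?K (\<lambda>n z. \<Prod>i<n. ?f i z)"
  proof (rule uniformly_convergent_on_prod')
    show "uniformly_convergent_on ?K (\<lambda>n z. \<Sum>i<n. norm (?f i z - 1))"
      by (rule Weierstrass_m_test'[OF _ summable_alpha_beta]) (use thoma_factor(2) in auto)
    show "continuous_on ?K (?f n)" for n
      using thoma_factor(1) by (intro continuous_intros) auto
  qed auto
  then obtain l where l: "uniform_limit ?K (\<lambda>n z. \<Prod>i<n. ?f i z) l sequentially"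
    by (auto simp: uniformly_convergent_on_def)
  moreover have "l z = (\<Prod>i. ?f i z)" if "z \<in> ?K" for z
    using tendsto_uniform_limitI[OF l that] thoma_product_LIMSEQ[of z] that
    by (intro LIMSEQ_unique) auto
  ultimately show ?thesis
    by (subst uniform_limit_cong'[where i = l and g = "\<lambda>n z. \<Prod>i<n. ?f i z"]) auto
qed

lemma thoma_product_holomorphic:
  "(\<lambda>z. \<Prod>i. (1 + complex_of_real (beta \<omega> i) * z) / (1 - of_real (alpha \<omega> i) * z))
    holomorphic_on ball 0 (thoma_radius \<omega>)"
proof (rule holomorphic_uniform_sequence)
  show "(\<lambda>z. \<Prod>i<n. (1 + complex_of_real (beta \<omega> i) * z) / (1 - of_real (alpha \<omega> i) * z))
      holomorphic_on ball 0 (thoma_radius \<omega>)" for n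
    using thoma_factor(1) by (intro holomorphic_intros) auto
  fix z assume "z \<in> ball (0 :: complex) (thoma_radius \<omega>)"
  then obtain d where d: "d > 0" "cball z d \<subseteq> ball 0 (thoma_radius \<omega>)"
    using open_contains_cball[of "ball (0 :: complex) (thoma_radius \<omega>)"] open_ball by blast
  then have "cball z d \<subseteq> cball 0 (thoma_radius \<omega>)"
    using ball_subset_cball by blast
  then show "\<exists>d>0. cball z d \<subseteq> ball 0 (thoma_radius \<omega>) \<and> uniform_limit (cball z d)
      (\<lambda>n z. \<Prod>i<n. (1 + complex_of_real (beta \<omega> i) * z) / (1 - of_real (alpha \<omega> i) * z))
      (\<lambda>z. \<Prod>i. (1 + of_real (beta \<omega> i) * z) / (1 - of_real (alpha \<omega> i) * z)) sequentially"
    using d by (intro exI[of _ d] conjI uniform_limit_on_subset[OF thoma_product_uniform_limit])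
qed auto

lemma thoma_gen_holomorphic: "thoma_gen \<omega> holomorphic_on ball 0 (thoma_radius \<omega>)"
  unfolding thoma_gen_def[abs_def] by (intro holomorphic_intros thoma_product_holomorphic)

lemma thoma_gen_0 [simp]: "thoma_gen \<omega> 0 = 1"
  by (simp add: thoma_gen_def)

text \<open>The product contributes \<open>\<Sum>(\<alpha>\<^sub>i + \<beta>\<^sub>i)\<close> to the derivative at 0 and the exponential
contributes \<open>\<gamma>\<close>, which is defined so as to complete the sum to \<open>\<delta>\<close>.\<close>

lemma thoma_gen_deriv_0: "(thoma_gen \<omega> has_field_derivative of_real (delta \<omega>)) (at 0)"
proof -
  let ?f = "\<lambda>i z. (1 + complex_of_real (beta \<omega> i) * z) / (1 - of_real (alpha \<omega> i) * z)"
  let ?P = "\<lambda>z. \<Prod>i. ?f i z"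
  have "((\<lambda>z. \<Prod>i<n. ?f i z) has_field_derivative of_real (\<Sum>i<n. alpha \<omega> i + beta \<omega> i)) (at 0)" for n
    by (induction n) (auto intro!: derivative_eq_intros simp: algebra_simps)
  then have "deriv (\<lambda>z. \<Prod>i<n. ?f i z) 0 = of_real (\<Sum>i<n. alpha \<omega> i + beta \<omega> i)" for n
    by (intro DERIV_imp_deriv)
  moreover have "(\<lambda>n. (deriv ^^ 1) (\<lambda>z. \<Prod>i<n. ?f i z) 0) \<longlonglongrightarrow> (deriv ^^ 1) ?P 0"
  proof (rule higher_deriv_complex_uniform_limit[where A = "ball 0 (thoma_radius \<omega>)"])
    show "uniform_limit (ball 0 (thoma_radius \<omega>)) (\<lambda>n z. \<Prod>i<n. ?f i z) ?P sequentially"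
      using thoma_product_uniform_limit ball_subset_cball by (rule uniform_limit_on_subset)
    show "\<forall>\<^sub>F n in sequentially. (\<lambda>z. \<Prod>i<n. ?f i z) holomorphic_on ball 0 (thoma_radius \<omega>)"
      using thoma_factor(1) by (intro always_eventually allI holomorphic_intros) auto
  qed (use thoma_radius_pos in auto)
  ultimately have "(\<lambda>n. complex_of_real (\<Sum>i<n. alpha \<omega> i + beta \<omega> i)) \<longlonglongrightarrow> deriv ?P 0"
    by simp
  moreover have "(\<lambda>n. complex_of_real (\<Sum>i<n. alpha \<omega> i + beta \<omega> i)) \<longlonglongrightarrow> of_real (\<Sum>i. alpha \<omega> i + beta \<omega> i)"
    by (intro tendsto_of_real summable_LIMSEQ summable_alpha_beta)
  ultimately have "deriv ?P 0 = of_real (\<Sum>i. alpha \<omega> i + beta \<omega> i)"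
    by (rule LIMSEQ_unique)
  then have "(?P has_field_derivative of_real (\<Sum>i. alpha \<omega> i + beta \<omega> i)) (at 0)"
    using holomorphic_derivI[OF thoma_product_holomorphic, of 0] thoma_radius_pos by simp
  then show ?thesis
    unfolding thoma_gen_def[abs_def] by (auto intro!: derivative_eq_intros simp: gamma_def)
qed

lemma thoma_gen_cnj:
  assumes "norm z \<le> thoma_radius \<omega>"
  shows "thoma_gen \<omega> (cnj z) = cnj (thoma_gen \<omega> z)"
proof -
  let ?f = "\<lambda>i z. (1 + complex_of_real (beta \<omega> i) * z) / (1 - of_real (alpha \<omega> i) * z)"
  have "(\<lambda>n. cnj (\<Prod>i<n. ?f i z)) \<longlonglongrightarrow> cnj (\<Prod>i. ?f i z)"
    by (intro tendsto_cnj thoma_product_LIMSEQ assms)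
  moreover have "(\<lambda>n. \<Prod>i<n. ?f i (cnj z)) \<longlonglongrightarrow> (\<Prod>i. ?f i (cnj z))"
    by (intro thoma_product_LIMSEQ) (use assms in simp)
  ultimately have "(\<Prod>i. ?f i (cnj z)) = cnj (\<Prod>i. ?f i z)"
    by (intro LIMSEQ_unique[of "\<lambda>n. \<Prod>i<n. ?f i (cnj z)"]) (auto simp: cnj_prod)
  then show ?thesis
    by (simp add: thoma_gen_def exp_cnj)
qed

lemma thoma_gen_of_real:
  assumes "\<bar>t\<bar> \<le> thoma_radius \<omega>"
  shows "thoma_gen \<omega> (of_real t) = of_real (thoma_h_gen \<omega> t)"
proof -
  let ?r = "\<lambda>i. (1 + beta \<omega> i * t) / (1 - alpha \<omega> i * t)"
  have eq: "(1 + complex_of_real (beta \<omega> i) * of_real t) / (1 - of_real (alpha \<omega> i) * of_real t) = of_real (?r i)" for i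
    by simp
  have "\<bar>?r i - 1\<bar> \<le> alpha \<omega> i + beta \<omega> i" for i
  proof -
    have "norm (complex_of_real (?r i) - 1) \<le> alpha \<omega> i + beta \<omega> i"
      using thoma_factor(2)[of "of_real t" i] assms unfolding eq by simp
    also have "complex_of_real (?r i) - 1 = of_real (?r i - 1)" by simp
    finally show ?thesis by (simp only: norm_of_real)
  qed
  then have "summable (\<lambda>i. norm (?r i - 1))"
    by (intro summable_comparison_test'[OF summable_alpha_beta, of 0]) simp
  then have "convergent_prod ?r"
    by (simp add: abs_convergent_prod_conv_summable abs_convergent_prod_imp_convergent_prod)
  then have "(\<lambda>n. \<Prod>i<n. ?r i) \<longlonglongrightarrow> (\<Prod>i. ?r i)"
    using convergent_prod_LIMSEQ LIMSEQ_lessThan_iff_atMost by blast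
  then have "(\<lambda>n. complex_of_real (\<Prod>i<n. ?r i)) \<longlonglongrightarrow> of_real (\<Prod>i. ?r i)"
    by (rule tendsto_of_real)
  moreover have "(\<lambda>n. complex_of_real (\<Prod>i<n. ?r i)) \<longlonglongrightarrow>
      (\<Prod>i. (1 + of_real (beta \<omega> i) * of_real t) / (1 - of_real (alpha \<omega> i) * of_real t))"
    using thoma_product_LIMSEQ[of "of_real t"] assms by simp
  ultimately have "(\<Prod>i. (1 + complex_of_real (beta \<omega> i) * of_real t) / (1 - of_real (alpha \<omega> i) * of_real t)) =
      of_real (\<Prod>i. ?r i)"
    by (rule LIMSEQ_unique[symmetric])
  then show ?thesis
    by (simp add: thoma_gen_def thoma_h_gen_def exp_of_real flip: of_real_mult)
qed

text \<open>The definition of \<open>h\<^sub>k\<close> speaks of a real expansion. The real parts of the complex Taylor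
coefficients provide one, and there is no other.\<close>

lemma thoma_h_eq:
  "thoma_h \<omega> (int n) = Re ((deriv ^^ n) (thoma_gen \<omega>) 0) / fact n"
proof -
  define G where "G = Abs_fps (\<lambda>n. Re ((deriv ^^ n) (thoma_gen \<omega>) 0) / fact n)"
  have "thoma_h_gen \<omega> has_fps_expansion G"
  proof (rule has_fps_expansionI)
    have "eventually (\<lambda>t. t \<in> ball (0 :: real) (thoma_radius \<omega>)) (nhds 0)"
      using thoma_radius_pos by (intro eventually_nhds_in_open) auto
    then show "eventually (\<lambda>t. (\<lambda>n. fps_nth G n * t ^ n) sums thoma_h_gen \<omega> t) (nhds 0)"
    proof eventually_elim
      case (elim t)
      then have "(\<lambda>n. (deriv ^^ n) (thoma_gen \<omega>) 0 / fact n * (of_real t - 0) ^ n) sums thoma_gen \<omega> (of_real t)"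
        by (intro holomorphic_power_series[OF thoma_gen_holomorphic]) simp
      then have sums: "(\<lambda>n. Re ((deriv ^^ n) (thoma_gen \<omega>) 0 / fact n * of_real (t ^ n))) sums Re (thoma_gen \<omega> (of_real t))"
        by (intro sums_Re) simp
      have Re: "Re (z / fact n * of_real x) = Re z / fact n * x" for z n x
      proof -
        have "z / fact n * of_real x = of_real (x / fact n) * z" by simp
        then show ?thesis by (simp only: Re_of_real_mult) simp
      qed
      have "thoma_gen \<omega> (of_real t) = of_real (thoma_h_gen \<omega> t)"
        using elim by (intro thoma_gen_of_real) simp
      with sums show ?case
        unfolding Re by (simp add: G_def)
    qed
  qed
  then have "(THE F. thoma_h_gen \<omega> has_fps_expansion F) = G"
    using has_fps_expansion_unique by blast
  then show ?thesis
    by (simp add: thoma_h_def G_def)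
qed

text \<open>The one identity that links the two sides of the theorem: scaling the parameters by
\<open>\<epsilon>\<close> is scaling the variable, and the only difference to the generating function of the
\<open>h\<^sub>k\<close> is the base point, which moves from \<open>u = 0\<close> to \<open>u = 1\<close>.\<close>

lemma Phi_thoma_scale:
  "Phi u (thoma_scale \<epsilon> \<omega>) thoma_zero = thoma_gen \<omega> (of_real \<epsilon> * (u - 1))"
proof -
  have "(\<Sum>i. \<epsilon> * alpha \<omega> i + \<epsilon> * beta \<omega> i) = \<epsilon> * (\<Sum>i. alpha \<omega> i + beta \<omega> i)"
    using suminf_mult[OF summable_alpha_beta, of \<epsilon>] by (simp only: distrib_left)
  then have "gamma (thoma_scale \<epsilon> \<omega>) = \<epsilon> * gamma \<omega>"
    by (simp add: gamma_def thoma_scale_def right_diff_distrib)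
  then show ?thesis
    by (simp add: Phi_def thoma_gen_def thoma_zero_def gamma_def[of "\<lparr>alpha = _, beta = _, delta = _\<rparr>"]
        thoma_scale_def mult_ac)
qed

text \<open>For \<open>\<bar>u\<bar> < 2\<close> the point \<open>\<epsilon> (u - 1)\<close> stays within \<open>3 \<epsilon>\<close> of
the origin, so the Laurent expansion is the Taylor expansion of \<open>thoma_gen\<close> about
\<open>- \<epsilon>\<close> in powers of \<open>\<epsilon> (u - 1) + \<epsilon> = \<epsilon> u\<close>.\<close>

lemma phi_thoma_scale:
  assumes "0 < \<epsilon>" "3 * \<epsilon> \<le> thoma_radius \<omega>"
  shows "phi (thoma_scale \<epsilon> \<omega>) thoma_zero k =
    (if k < 0 then 0 else \<epsilon> ^ nat k * (Re ((deriv ^^ nat k) (thoma_gen \<omega>) (of_real (- \<epsilon>))) / fact (nat k)))"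
proof -
  define a where "a = (\<lambda>n. (deriv ^^ n) (thoma_gen \<omega>) (of_real (- \<epsilon>)) / fact n * of_real \<epsilon> ^ n)"
  have norm_le: "norm (of_real \<epsilon> * (u - 1)) < thoma_radius \<omega>" if "norm u < 2" for u :: complex
  proof -
    have "norm (u - 1) < 3" using norm_triangle_ineq4[of u 1] that by simp
    then have "\<epsilon> * norm (u - 1) < \<epsilon> * 3" using assms(1) by (intro mult_strict_left_mono) auto
    moreover have "norm (of_real \<epsilon> * (u - 1)) = \<epsilon> * norm (u - 1)"
      using assms(1) by (simp add: norm_mult)
    ultimately show ?thesis using assms(2) by linarith
  qed
  let ?c = "\<lambda>k. if k < 0 then 0 else Re (a (nat k))"
  have "has_laurent_expansion_on_circle (\<lambda>u. thoma_gen \<omega> (of_real \<epsilon> * (u - 1))) ?c"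
  proof (rule has_laurent_expansion_on_circle_power_series[of 2])
    fix u :: complex assume u: "norm u < 2"
    have "ball (of_real (- \<epsilon>)) (2 * \<epsilon>) \<subseteq> ball (0 :: complex) (thoma_radius \<omega>)"
      using assms by (subst ball_subset_ball_iff) (auto simp: dist_norm)
    then have holo: "thoma_gen \<omega> holomorphic_on ball (of_real (- \<epsilon>)) (2 * \<epsilon>)"
      by (rule holomorphic_on_subset[OF thoma_gen_holomorphic])
    have diff: "of_real \<epsilon> * (u - 1) - of_real (- \<epsilon>) = of_real \<epsilon> * u"
      by (simp add: algebra_simps)
    have "dist (of_real \<epsilon> * (u - 1)) (of_real (- \<epsilon>)) < 2 * \<epsilon>"
      unfolding dist_norm diff using u assms(1) by (simp add: norm_mult)
    then have "of_real \<epsilon> * (u - 1) \<in> ball (of_real (- \<epsilon>)) (2 * \<epsilon>)"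
      by (simp only: mem_ball dist_commute)
    from holomorphic_power_series[OF holo this]
    show "(\<lambda>n. a n * u ^ n) sums thoma_gen \<omega> (of_real \<epsilon> * (u - 1))"
      unfolding diff by (simp add: a_def power_mult_distrib mult_ac)
    show "thoma_gen \<omega> (of_real \<epsilon> * (cnj u - 1)) = cnj (thoma_gen \<omega> (of_real \<epsilon> * (u - 1)))"
      using thoma_gen_cnj[of "of_real \<epsilon> * (u - 1)"] norm_le[OF u] by simp
  qed simp
  then have "phi (thoma_scale \<epsilon> \<omega>) thoma_zero = ?c"
    unfolding phi_def Phi_thoma_scale using has_laurent_expansion_on_circle_unique by blast
  moreover have "Re (a n) = \<epsilon> ^ n * (Re ((deriv ^^ n) (thoma_gen \<omega>) (of_real (- \<epsilon>))) / fact n)" for n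
  proof -
    have "a n = of_real (\<epsilon> ^ n / fact n) * (deriv ^^ n) (thoma_gen \<omega>) (of_real (- \<epsilon>))"
      by (simp add: a_def)
    then show ?thesis by (simp only: Re_of_real_mult) simp
  qed
  ultimately show ?thesis by simp
qed

lemma eventually_small_scale:
  "eventually (\<lambda>\<epsilon>. 0 < \<epsilon> \<and> 3 * \<epsilon> \<le> thoma_radius \<omega>) (at_right 0)"
proof -
  have "eventually (\<lambda>\<epsilon>. \<epsilon> \<in> {0<..<thoma_radius \<omega> / 3}) (at_right 0)"
    using thoma_radius_pos by (intro eventually_at_right_real) simp
  then show ?thesis by eventually_elim auto
qed

text \<open>The Taylor coefficients about \<open>- \<epsilon>\<close> tend to those about 0.\<close>

lemma phi_scaling_limit:
  "((\<lambda>\<epsilon>. phi (thoma_scale \<epsilon> \<omega>) thoma_zero k / \<epsilon> powi k) \<longlongrightarrow> thoma_h \<omega> k) (at_right 0)"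
proof (cases "k < 0")
  case True
  have "eventually (\<lambda>\<epsilon>. 0 = phi (thoma_scale \<epsilon> \<omega>) thoma_zero k / \<epsilon> powi k) (at_right 0)"
    using eventually_small_scale by eventually_elim (use True in \<open>simp add: phi_thoma_scale\<close>)
  then show ?thesis
    using True by (auto simp: thoma_h_def intro: Lim_transform_eventually)
next
  case False
  define n where "n = nat k"
  have k: "k = int n" using False by (simp add: n_def)
  have "isCont ((deriv ^^ n) (thoma_gen \<omega>)) 0"
    using holomorphic_higher_deriv[OF thoma_gen_holomorphic, of n] thoma_radius_pos
    by (auto intro!: continuous_on_interior[of "ball 0 (thoma_radius \<omega>)"] holomorphic_on_imp_continuous_on)
  moreover have "((\<lambda>\<epsilon>. complex_of_real (- \<epsilon>)) \<longlongrightarrow> 0) (at_right 0)"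
    by (auto intro!: tendsto_eq_intros)
  ultimately have "((\<lambda>\<epsilon>. (deriv ^^ n) (thoma_gen \<omega>) (of_real (- \<epsilon>))) \<longlongrightarrow> (deriv ^^ n) (thoma_gen \<omega>) 0) (at_right 0)"
    by (rule isCont_tendsto_compose)
  then have "((\<lambda>\<epsilon>. Re ((deriv ^^ n) (thoma_gen \<omega>) (of_real (- \<epsilon>))) / fact n) \<longlongrightarrow> thoma_h \<omega> (int n)) (at_right 0)"
    unfolding thoma_h_eq by (intro tendsto_intros) auto
  moreover have "eventually (\<lambda>\<epsilon>. Re ((deriv ^^ n) (thoma_gen \<omega>) (of_real (- \<epsilon>))) / fact n =
      phi (thoma_scale \<epsilon> \<omega>) thoma_zero (int n) / \<epsilon> powi int n) (at_right 0)"
    using eventually_small_scale by eventually_elim (simp add: phi_thoma_scale)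
  ultimately show ?thesis
    unfolding k by (rule Lim_transform_eventually)
qed

text \<open>Since \<open>\<phi>\<^sub>0\<close> is the value of \<open>thoma_gen\<close> at \<open>- \<epsilon>\<close>, its
logarithm is \<open>- \<epsilon> \<delta> + o(\<epsilon>)\<close>.\<close>

lemma phi_0_power_limit:
  assumes "((\<lambda>\<epsilon>. real (N \<epsilon>) * \<epsilon>) \<longlongrightarrow> r) (at_right 0)"
  shows "((\<lambda>\<epsilon>. phi (thoma_scale \<epsilon> \<omega>) thoma_zero 0 ^ N \<epsilon>) \<longlongrightarrow> exp (- r * delta \<omega>)) (at_right 0)"
proof -
  define g where "g = (\<lambda>t. Re (thoma_gen \<omega> (of_real (- t))))"
  have "((\<lambda>z. thoma_gen \<omega> (- z)) has_field_derivative of_real (delta \<omega>) * - 1) (at (of_real 0))"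
  proof (rule DERIV_chain2[where f = "thoma_gen \<omega>" and g = uminus])
    show "(thoma_gen \<omega> has_field_derivative of_real (delta \<omega>)) (at (- of_real 0))"
      using thoma_gen_deriv_0 by simp
    show "(uminus has_field_derivative - 1) (at (of_real 0 :: complex))"
      by (auto intro!: derivative_eq_intros)
  qed
  then have "((\<lambda>z. thoma_gen \<omega> (- z)) has_field_derivative of_real (- delta \<omega>)) (at (of_real 0))"
    by simp
  then have "((\<lambda>t. thoma_gen \<omega> (- of_real t)) has_vector_derivative of_real (- delta \<omega>)) (at 0)"
    by (rule has_vector_derivative_real_field)
  from bounded_linear.has_vector_derivative[OF bounded_linear_Re this]
  have g_deriv: "(g has_field_derivative (- delta \<omega>)) (at 0)"
    by (simp add: g_def has_real_derivative_iff_has_vector_derivative)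
  have g0: "g 0 = 1" by (simp add: g_def)
  have "((\<lambda>t. ln (g t)) has_field_derivative (- delta \<omega>)) (at 0)"
    using g_deriv g0 by (auto intro!: derivative_eq_intros)
  then have "((\<lambda>\<epsilon>. ln (g \<epsilon>) / \<epsilon>) \<longlongrightarrow> - delta \<omega>) (at 0)"
    using g0 by (simp add: has_field_derivative_iff)
  then have "((\<lambda>\<epsilon>. ln (g \<epsilon>) / \<epsilon>) \<longlongrightarrow> - delta \<omega>) (at_right 0)"
    by (rule filterlim_mono[OF _ order_refl]) (simp add: at_le)
  then have "((\<lambda>\<epsilon>. exp ((real (N \<epsilon>) * \<epsilon>) * (ln (g \<epsilon>) / \<epsilon>))) \<longlongrightarrow> exp (r * - delta \<omega>)) (at_right 0)"
    by (intro tendsto_intros assms)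
  moreover have "eventually (\<lambda>\<epsilon>. g \<epsilon> > 0) (at_right 0)"
  proof -
    have "isCont g 0" using g_deriv by (rule DERIV_isCont)
    then have "(g \<longlongrightarrow> 1) (at_right 0)"
      unfolding isCont_def g0 by (rule filterlim_mono[OF _ order_refl]) (simp add: at_le)
    then show ?thesis by (rule order_tendstoD) simp
  qed
  then have "eventually (\<lambda>\<epsilon>. exp ((real (N \<epsilon>) * \<epsilon>) * (ln (g \<epsilon>) / \<epsilon>)) =
      phi (thoma_scale \<epsilon> \<omega>) thoma_zero 0 ^ N \<epsilon>) (at_right 0)"
    using eventually_small_scale
  proof eventually_elim
    case (elim \<epsilon>)
    then have "phi (thoma_scale \<epsilon> \<omega>) thoma_zero 0 = g \<epsilon>"
      by (simp add: phi_thoma_scale g_def)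
    then show ?case using elim by (simp add: exp_of_nat_mult)
  qed
  ultimately show ?thesis
    by (auto intro: Lim_transform_eventually)
qed

end

section \<open>The limit relation\<close>

lemma young_diagram_rows_above:
  assumes "young_diagram \<mu>" "num_rows \<mu> \<le> i"
  shows "\<mu> i = 0"
proof (rule ccontr)
  assume "\<mu> i \<noteq> 0"
  then have "{..i} \<subseteq> {i. \<mu> i \<noteq> 0}"
    using assms(1) by (force simp: young_diagram_def antimono_def)
  from card_mono[OF _ this] assms show False
    by (simp add: young_diagram_def num_rows_def)
qed

text \<open>Below row \<open>n\<close> the matrix is upper triangular with diagonal \<open>c 0\<close>. In the block that
remains, \<open>\<epsilon> powi (\<mu>\<^sub>i - i + j)\<close> is a product of a row factor and a column factor, and
these multiply up to \<open>\<epsilon> ^ |\<mu>|\<close> because the shifts \<open>j - i\<close> cancel.\<close>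

lemma det_phi_factorisation:
  assumes zero: "\<And>i. n \<le> i \<Longrightarrow> \<mu> i = 0" and "n \<le> N"
    and neg: "\<And>k. k < 0 \<Longrightarrow> c k = 0" and "\<epsilon> \<noteq> 0"
  shows "det_of N (\<lambda>i j. c (int (\<mu> i) - int i + int j)) =
    \<epsilon> ^ (\<Sum>i<n. \<mu> i) * det_of n (\<lambda>i j. c (int (\<mu> i) - int i + int j) / \<epsilon> powi (int (\<mu> i) - int i + int j))
      * c 0 ^ (N - n)"
proof -
  let ?f = "\<lambda>i j. c (int (\<mu> i) - int i + int j)"
  obtain m where N: "N = n + m" using \<open>n \<le> N\<close> le_Suc_ex by blast
  have "det_of N ?f = det_of n ?f * det_of m (\<lambda>i j. ?f (n + i) (n + j))"
    unfolding N by (rule det_of_block_upper) (auto simp: zero intro!: neg)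
  also have "det_of m (\<lambda>i j. ?f (n + i) (n + j)) = c 0 ^ m"
    by (rule det_of_upper_triangular_const) (auto simp: zero intro!: neg)
  also have "det_of n ?f = det_of n (\<lambda>i j. \<epsilon> powi (int (\<mu> i) - int i) * \<epsilon> ^ j *
      (?f i j / \<epsilon> powi (int (\<mu> i) - int i + int j)))"
    using \<open>\<epsilon> \<noteq> 0\<close> by (intro det_of_cong) (simp add: power_int_add)
  also have "\<dots> = (\<Prod>i<n. \<epsilon> powi (int (\<mu> i) - int i)) * (\<Prod>j<n. \<epsilon> ^ j) *
      det_of n (\<lambda>i j. ?f i j / \<epsilon> powi (int (\<mu> i) - int i + int j))"
    by (rule det_of_scale)
  also have "(\<Prod>i<n. \<epsilon> powi (int (\<mu> i) - int i)) * (\<Prod>j<n. \<epsilon> ^ j) = \<epsilon> ^ (\<Sum>i<n. \<mu> i)"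
    using \<open>\<epsilon> \<noteq> 0\<close> by (simp add: power_sum power_int_diff flip: prod.distrib)
  finally show ?thesis by (simp add: N)
qed

theorem theorem4p5p1:
  fixes \<omega> :: thoma_triple and \<mu> :: "nat \<Rightarrow> nat" and r :: real and N :: "real \<Rightarrow> nat"
  assumes "\<omega> \<in> thoma_cone"
    and "young_diagram \<mu>"
    and "r > 0"
    and "\<And>\<epsilon>. \<epsilon> > 0 \<Longrightarrow> N \<epsilon> > 0"
    and "(\<lambda>\<epsilon>. real (N \<epsilon>)) \<sim>[at_right 0] (\<lambda>\<epsilon>. r * inverse \<epsilon>)"
  shows "((\<lambda>\<epsilon>. Lambda_GT (N \<epsilon>) (thoma_scale \<epsilon> \<omega>) thoma_zero (\<lambda>i. int (\<mu> i)))
            \<longlongrightarrow> Lambda_YB r \<omega> \<mu>) (at_right 0)"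
proof -
  define n where "n = num_rows \<mu>"
  define s where "s = (\<Sum>i<n. \<mu> i)"
  let ?ph = "\<lambda>\<epsilon> k. phi (thoma_scale \<epsilon> \<omega>) thoma_zero k"
  let ?k = "\<lambda>i j. int (\<mu> i) - int i + int j"
  have zero: "\<mu> i = 0" if "n \<le> i" for i
    using young_diagram_rows_above[OF assms(2)] that by (simp add: n_def)
  have s: "num_boxes \<mu> = s"
    unfolding s_def by (rule num_boxes_eq_sum) (rule zero)
  have pos: "eventually (\<lambda>\<epsilon>::real. \<epsilon> > 0) (at_right 0)"
    by (simp add: eventually_at_right_less)
  have "((\<lambda>\<epsilon>. real (N \<epsilon>) / (r * inverse \<epsilon>)) \<longlongrightarrow> 1) (at_right 0)"
    using assms(3,5) by (intro asymp_equivD_strong) (auto intro: eventually_mono[OF pos])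
  then have "((\<lambda>\<epsilon>. r * (real (N \<epsilon>) / (r * inverse \<epsilon>))) \<longlongrightarrow> r * 1) (at_right 0)"
    by (intro tendsto_intros)
  then have N_eps: "((\<lambda>\<epsilon>. real (N \<epsilon>) * \<epsilon>) \<longlongrightarrow> r) (at_right 0)"
    using assms(3) by (simp add: field_simps)
  have "filterlim (\<lambda>\<epsilon>. real (N \<epsilon>) * \<epsilon> * inverse \<epsilon>) at_top (at_right 0)"
    by (rule filterlim_tendsto_pos_mult_at_top[OF N_eps assms(3) filterlim_inverse_at_top_right])
  then have "filterlim (\<lambda>\<epsilon>. real (N \<epsilon>)) at_top (at_right 0)"
    by (rule filterlim_mono_eventually[OF _ order_refl order_refl]) (auto intro: eventually_mono[OF pos])
  then have N_real_top: "eventually (\<lambda>\<epsilon>. b \<le> real (N \<epsilon>)) (at_right 0)" for b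
    by (simp add: filterlim_at_top)
  have N_top: "filterlim N at_top (at_right 0)"
    unfolding filterlim_at_top
  proof
    show "eventually (\<lambda>\<epsilon>. b \<le> N \<epsilon>) (at_right 0)" for b
      using N_real_top[of "real b"] by simp
  qed
  have Dim: "((\<lambda>\<epsilon>. Dim_GT (\<lambda>i. int (\<mu> i)) (N \<epsilon>) * \<epsilon> ^ s) \<longlongrightarrow> r ^ s * (real (dim_YB \<mu>) / fact s)) (at_right 0)"
    using Dim_GT_asymp[OF zero N_top N_eps tendsto_ident_at] dim_YB_eq_det[OF assms(2) zero] s
    by (simp add: s_def)
  have det: "((\<lambda>\<epsilon>. det_of n (\<lambda>i j. ?ph \<epsilon> (?k i j) / \<epsilon> powi ?k i j)) \<longlongrightarrow> thoma_S \<mu> \<omega>) (at_right 0)"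
    unfolding thoma_S_def n_def[symmetric] by (intro tendsto_det_of phi_scaling_limit assms(1))
  \<comment> \<open>Dropping the \<open>n\<close> rows of the diagram does not change the limit of \<open>N \<epsilon>\<close> times \<open>\<epsilon>\<close>.\<close>
  have power: "((\<lambda>\<epsilon>. ?ph \<epsilon> 0 ^ (N \<epsilon> - n)) \<longlongrightarrow> exp (- r * delta \<omega>)) (at_right 0)"
  proof (rule phi_0_power_limit[OF assms(1)])
    have "((\<lambda>\<epsilon>. real (N \<epsilon>) * \<epsilon> - real n * \<epsilon>) \<longlongrightarrow> r - real n * 0) (at_right 0)"
      by (intro tendsto_intros N_eps)
    moreover have "eventually (\<lambda>\<epsilon>. n \<le> N \<epsilon>) (at_right 0)"
      using N_top by (simp add: filterlim_at_top)
    then have "eventually (\<lambda>\<epsilon>. real (N \<epsilon>) * \<epsilon> - real n * \<epsilon> = real (N \<epsilon> - n) * \<epsilon>) (at_right 0)"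
      by eventually_elim (simp add: of_nat_diff algebra_simps)
    ultimately show "((\<lambda>\<epsilon>. real (N \<epsilon> - n) * \<epsilon>) \<longlongrightarrow> r) (at_right 0)"
      by (force intro: Lim_transform_eventually)
  qed
  from tendsto_mult[OF tendsto_mult[OF Dim det] power]
  have lim: "((\<lambda>\<epsilon>. Dim_GT (\<lambda>i. int (\<mu> i)) (N \<epsilon>) * \<epsilon> ^ s *
      det_of n (\<lambda>i j. ?ph \<epsilon> (?k i j) / \<epsilon> powi ?k i j) * ?ph \<epsilon> 0 ^ (N \<epsilon> - n)) \<longlongrightarrow> Lambda_YB r \<omega> \<mu>) (at_right 0)"
    by (simp add: Lambda_YB_def s mult_ac)
  have "eventually (\<lambda>\<epsilon>. n \<le> N \<epsilon>) (at_right 0)"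
    using N_top by (simp add: filterlim_at_top)
  then have ev: "eventually (\<lambda>\<epsilon>. Dim_GT (\<lambda>i. int (\<mu> i)) (N \<epsilon>) * \<epsilon> ^ s *
      det_of n (\<lambda>i j. ?ph \<epsilon> (?k i j) / \<epsilon> powi ?k i j) * ?ph \<epsilon> 0 ^ (N \<epsilon> - n) =
      Lambda_GT (N \<epsilon>) (thoma_scale \<epsilon> \<omega>) thoma_zero (\<lambda>i. int (\<mu> i))) (at_right 0)"
    using eventually_small_scale[OF assms(1)]
  proof eventually_elim
    case (elim \<epsilon>)
    have "det_of (N \<epsilon>) (\<lambda>i j. ?ph \<epsilon> (?k i j)) =
        \<epsilon> ^ s * det_of n (\<lambda>i j. ?ph \<epsilon> (?k i j) / \<epsilon> powi ?k i j) * ?ph \<epsilon> 0 ^ (N \<epsilon> - n)"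
      unfolding s_def using elim
      by (intro det_phi_factorisation zero) (auto simp: phi_thoma_scale[OF assms(1)])
    then show ?case by (simp add: Lambda_GT_def)
  qed
  from Lim_transform_eventually[OF lim ev] show ?thesis .
qed

end
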